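(* Let $X\subset\mathbb{Z}_p^n$ be a compact open subset of a smooth algebraic set of dimension $d$. Then there exists $m_0=m_0(X)>0$ such that for all $m\geq m_0$ we have $$N_m(X)=p^{(m-m_0)d}\,N_{m_0}(X).$$
   Context: $p$ is a prime. $N_m(X)$ is the cardinality of the image of $X$ under the reduction map $\mathbb{Z}_p^n\to(\mathbb{Z}/p^m\mathbb{Z})^n$. An algebraic set is the set of points of the zero locus of polynomials with coefficients in $\mathbb{Q}_p$; it is smooth of dimension $d$ if at each of its points it is locally defined (generating the ideal locally) by $n-d$ polynomial equations whose Jacobian matrix has rank $n-d$ at that point. "Compact open" refers to the $p$-adic topology on the algebraic set. *)

theory Defs
  imports
    "HOL-Analysis.Analysis"
    "HOL-Library.Poly_Mapping"
    "HOL-Computational_Algebra.Polynomial_Factorial"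
begin

section \<open>The $p$-adic integers\<close>

text \<open>The prime $p$ is carried by a type of cardinality $p$.\<close>

class prime_card = finite +
  assumes prime_CARD: "prime CARD('a)"

text \<open>The ring of $p$-adic integers is the inverse limit of the rings $\mathbb{Z}/p^m$; the class
  modulo $p^m$ is given by its representative in the range from $0$ to $p^m - 1$. The morphism
  \<open>residue\<close> is thus the reduction map from the $p$-adic integers to $\mathbb{Z}/p^m$.\<close>

typedef (overloaded) 'p padic_int =
    "{x :: nat \<Rightarrow> int. \<forall>m. x (Suc m) mod int CARD('p::prime_card) ^ m = x m}"
  morphisms residue Abs_padic_int
  by (rule exI[of _ "\<lambda>_. 0"]) simp

setup_lifting type_definition_padic_int

lemma mod_power_mod_power: "a mod p ^ Suc m mod p ^ m = a mod (p::int) ^ m"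
  by (rule mod_mod_cancel) (simp add: le_imp_power_dvd)

lemma residue_mod:
  fixes x :: "'p::prime_card padic_int"
  assumes "k \<le> m"
  shows "residue x m mod int CARD('p) ^ k = residue x k"
proof -
  have *: "residue x (Suc m) mod int CARD('p) ^ m = residue x m" for m
    using residue[of x] by blast
  from assms show ?thesis
  proof (induction m rule: dec_induct)
    case base
    show ?case
      by (subst (1 2) *[symmetric]) (rule mod_mod_trivial)
  next
    case (step m)
    have "residue x (Suc m) mod int CARD('p) ^ k
        = residue x (Suc m) mod int CARD('p) ^ m mod int CARD('p) ^ k"
      by (rule mod_mod_cancel[symmetric]) (use step in \<open>simp add: le_imp_power_dvd\<close>)
    then show ?case
      by (simp only: * step)
  qed
qed

lemma residue_mod_same [simp]:
  "residue (x :: 'p::prime_card padic_int) m mod int CARD('p) ^ m = residue x m"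
  by (rule residue_mod) simp

lemma padic_int_eqI: "(\<And>m. residue x m = residue y m) \<Longrightarrow> x = y"
  by (simp add: residue_inject[symmetric] fun_eq_iff)

instantiation padic_int :: (prime_card) comm_ring_1
begin

lift_definition zero_padic_int :: "'a padic_int" is "\<lambda>_. 0" by simp

lift_definition one_padic_int :: "'a padic_int" is "\<lambda>m. 1 mod int CARD('a) ^ m"
  by (simp only: mod_power_mod_power)

lift_definition plus_padic_int :: "'a padic_int \<Rightarrow> 'a padic_int \<Rightarrow> 'a padic_int"
  is "\<lambda>x y m. (x m + y m) mod int CARD('a) ^ m"
  by (simp only: mod_power_mod_power) (metis mod_add_eq)

lift_definition times_padic_int :: "'a padic_int \<Rightarrow> 'a padic_int \<Rightarrow> 'a padic_int"
  is "\<lambda>x y m. (x m * y m) mod int CARD('a) ^ m"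
  by (simp only: mod_power_mod_power) (metis mod_mult_eq)

lift_definition uminus_padic_int :: "'a padic_int \<Rightarrow> 'a padic_int"
  is "\<lambda>x m. (- x m) mod int CARD('a) ^ m"
  by (simp only: mod_power_mod_power) (metis mod_minus_eq)

lift_definition minus_padic_int :: "'a padic_int \<Rightarrow> 'a padic_int \<Rightarrow> 'a padic_int"
  is "\<lambda>x y m. (x m - y m) mod int CARD('a) ^ m"
  by (simp only: mod_power_mod_power) (metis mod_diff_eq)

lemma residue_simps:
  fixes x y :: "'a padic_int"
  shows "residue (0 :: 'a padic_int) m = 0"
    and "residue (1 :: 'a padic_int) m = 1 mod int CARD('a) ^ m"
    and "residue (x + y) m = (residue x m + residue y m) mod int CARD('a) ^ m"
    and "residue (x * y) m = (residue x m * residue y m) mod int CARD('a) ^ m"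
    and "residue (- x) m = (- residue x m) mod int CARD('a) ^ m"
    and "residue (x - y) m = (residue x m - residue y m) mod int CARD('a) ^ m"
  by (simp_all add: zero_padic_int.rep_eq one_padic_int.rep_eq plus_padic_int.rep_eq
      times_padic_int.rep_eq uminus_padic_int.rep_eq minus_padic_int.rep_eq)

instance
proof
  fix a b c :: "'a padic_int"
  show "a * b * c = a * (b * c)"
    by (rule padic_int_eqI) (simp add: residue_simps mod_simps mult.assoc)
  show "a * b = b * a"
    by (rule padic_int_eqI) (simp add: residue_simps mult.commute)
  show "1 * a = a"
    by (rule padic_int_eqI) (simp add: residue_simps mod_simps)
  show "a + b + c = a + (b + c)"
    by (rule padic_int_eqI) (simp add: residue_simps mod_simps add.assoc)
  show "a + b = b + a"
    by (rule padic_int_eqI) (simp add: residue_simps add.commute)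
  show "0 + a = a"
    by (rule padic_int_eqI) (simp add: residue_simps)
  show "- a + a = 0"
    by (rule padic_int_eqI) (simp add: residue_simps mod_simps)
  show "a - b = a + - b"
    by (rule padic_int_eqI) (simp add: residue_simps mod_simps)
  show "(a + b) * c = a * c + b * c"
    by (rule padic_int_eqI) (simp add: residue_simps mod_simps distrib_right)
  have "1 mod int CARD('a) ^ 1 \<noteq> 0"
    using prime_gt_1_nat[OF prime_CARD[where 'a='a]] by simp
  then have "residue (0 :: 'a padic_int) 1 \<noteq> residue (1 :: 'a padic_int) 1"
    by (simp only: residue_simps)
  then show "0 \<noteq> (1 :: 'a padic_int)"
    by metis
qed

end

text \<open>The exponent of the largest power of $p$ dividing \<open>x\<close>, for nonzero \<open>x\<close>.\<close>

definition padic_val :: "'p::prime_card padic_int \<Rightarrow> nat" where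
  "padic_val x = (LEAST m. residue x (Suc m) \<noteq> 0)"

lemma residue_0 [simp]: "residue (x :: 'p::prime_card padic_int) 0 = 0"
  using residue_mod[of 0 0 x] by simp

lemma residue_eq_0_iff:
  fixes x :: "'p::prime_card padic_int"
  assumes "x \<noteq> 0"
  shows "residue x k = 0 \<longleftrightarrow> k \<le> padic_val x"
proof -
  obtain m where m: "residue x m \<noteq> 0"
    using assms padic_int_eqI[of x 0] by (auto simp: residue_simps)
  then obtain m' where "m = Suc m'"
    using residue_0 by (cases m) auto
  with m have "\<exists>m. residue x (Suc m) \<noteq> 0"
    by blast
  then have 1: "residue x (Suc (padic_val x)) \<noteq> 0"
    unfolding padic_val_def by (rule LeastI_ex)
  have 2: "residue x (padic_val x) = 0"
  proof (cases "padic_val x")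
    case (Suc j)
    then have "\<not> residue x (Suc j) \<noteq> 0"
      unfolding padic_val_def by (intro not_less_Least) simp
    then show ?thesis using Suc by simp
  qed simp
  show ?thesis
  proof
    assume "residue x k = 0"
    then show "k \<le> padic_val x"
      using residue_mod[of "Suc (padic_val x)" k x] 1 by (metis mod_0 not_less_eq_eq)
  next
    assume "k \<le> padic_val x"
    then show "residue x k = 0"
      using residue_mod[of k "padic_val x" x] 2 by simp
  qed
qed

lemma residue_eq_0_iff_dvd:
  fixes x :: "'p::prime_card padic_int"
  assumes "k \<le> m"
  shows "residue x k = 0 \<longleftrightarrow> int CARD('p) ^ k dvd residue x m"
  using residue_mod[OF assms, of x] by (simp add: dvd_eq_mod_eq_0)

lemma padic_val_mult_aux:
  fixes x y :: "'p::prime_card padic_int"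
  assumes "x \<noteq> 0" "y \<noteq> 0"
  shows "residue (x * y) k = 0 \<longleftrightarrow> k \<le> padic_val x + padic_val y"
proof -
  let ?p = "int CARD('p)" and ?v = "padic_val x" and ?w = "padic_val y"
  define m where "m = Suc (?v + ?w) + k"
  have p: "prime ?p"
    using prime_CARD[where 'a='p] by simp
  have p0: "?p \<noteq> 0"
    using p by auto
  have "?p ^ ?v dvd residue x m" "\<not> ?p ^ Suc ?v dvd residue x m"
    using residue_eq_0_iff_dvd[of ?v m x] residue_eq_0_iff_dvd[of "Suc ?v" m x]
      residue_eq_0_iff[OF assms(1)] by (auto simp: m_def simp del: power_Suc)
  then obtain u where u: "residue x m = ?p ^ ?v * u" "\<not> ?p dvd u"
    by (auto elim!: dvdE[of "?p ^ ?v"])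
  have "?p ^ ?w dvd residue y m" "\<not> ?p ^ Suc ?w dvd residue y m"
    using residue_eq_0_iff_dvd[of ?w m y] residue_eq_0_iff_dvd[of "Suc ?w" m y]
      residue_eq_0_iff[OF assms(2)] by (auto simp: m_def simp del: power_Suc)
  then obtain z where z: "residue y m = ?p ^ ?w * z" "\<not> ?p dvd z"
    by (auto elim!: dvdE[of "?p ^ ?w"])
  have uz: "\<not> ?p dvd u * z"
    using p u(2) z(2) by (simp add: prime_dvd_mult_iff)
  have "residue (x * y) m = (residue x m * residue y m) mod ?p ^ m"
    by (rule residue_simps)
  then have "?p ^ k dvd residue (x * y) m \<longleftrightarrow> ?p ^ k dvd residue x m * residue y m"
    by (simp add: dvd_mod_iff le_imp_power_dvd m_def)
  also have "residue x m * residue y m = ?p ^ (?v + ?w) * (u * z)"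
    by (simp add: u z power_add)
  also have "?p ^ k dvd \<dots> \<longleftrightarrow> k \<le> ?v + ?w"
  proof
    assume *: "?p ^ k dvd ?p ^ (?v + ?w) * (u * z)"
    show "k \<le> ?v + ?w"
    proof (rule ccontr)
      assume "\<not> k \<le> ?v + ?w"
      then have "?p ^ Suc (?v + ?w) dvd ?p ^ (?v + ?w) * (u * z)"
        using * by (meson dvd_trans le_imp_power_dvd not_less_eq_eq)
      then have "?p ^ (?v + ?w) * ?p dvd ?p ^ (?v + ?w) * (u * z)"
        by (simp only: power_Suc2)
      then show False
        using p0 uz by (simp only: dvd_mult_cancel_left) simp
    qed
  qed (simp add: le_imp_power_dvd)
  finally show ?thesis
    using residue_eq_0_iff_dvd[of k m "x * y"] by (simp add: m_def)
qed

instance padic_int :: (prime_card) idom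
proof
  fix x y :: "'a padic_int"
  assume *: "x \<noteq> 0" "y \<noteq> 0"
  show "x * y \<noteq> 0"
  proof
    assume "x * y = 0"
    then show False
      using padic_val_mult_aux[OF *, of "Suc (padic_val x + padic_val y)"]
      by (simp add: residue_simps)
  qed
qed

lemma padic_val_mult:
  fixes x y :: "'p::prime_card padic_int"
  assumes "x \<noteq> 0" "y \<noteq> 0"
  shows "padic_val (x * y) = padic_val x + padic_val y"
proof -
  have "x * y \<noteq> 0"
    using assms by simp
  then show ?thesis
    using padic_val_mult_aux[OF assms] residue_eq_0_iff[of "x * y"] by (metis le_antisym order_refl)
qed

lemma padic_val_add:
  fixes x y :: "'p::prime_card padic_int"
  assumes "x \<noteq> 0" "y \<noteq> 0" "x + y \<noteq> 0"
  shows "min (padic_val x) (padic_val y) \<le> padic_val (x + y)"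
proof -
  let ?k = "min (padic_val x) (padic_val y)"
  have "residue x ?k = 0" "residue y ?k = 0"
    using assms by (simp_all add: residue_eq_0_iff)
  then have "residue (x + y) ?k = 0"
    by (simp add: residue_simps)
  then show ?thesis
    using assms(3) by (simp add: residue_eq_0_iff)
qed

section \<open>The field of $p$-adic numbers\<close>

class nonarch_idom = idom +
  fixes nonarch_abs :: "'a \<Rightarrow> real"
  assumes nonarch_abs_nonneg: "0 \<le> nonarch_abs x"
    and nonarch_abs_eq_0_iff [simp]: "nonarch_abs x = 0 \<longleftrightarrow> x = 0"
    and nonarch_abs_mult: "nonarch_abs (x * y) = nonarch_abs x * nonarch_abs y"
    and nonarch_abs_add: "nonarch_abs (x + y) \<le> max (nonarch_abs x) (nonarch_abs y)"

lemma nonarch_abs_1 [simp]: "nonarch_abs (1 :: 'a::nonarch_idom) = 1"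
  using nonarch_abs_mult[of "1 :: 'a" 1] by simp

lemma nonarch_abs_minus [simp]: "nonarch_abs (- x) = nonarch_abs (x :: 'a::nonarch_idom)"
proof -
  have "nonarch_abs (- 1 :: 'a) * nonarch_abs (- 1 :: 'a) = 1"
    using nonarch_abs_mult[of "- 1 :: 'a" "- 1"] by simp
  then have "nonarch_abs (- 1 :: 'a) = 1"
    using nonarch_abs_nonneg[of "- 1 :: 'a"] by (auto simp: square_eq_1_iff)
  then show ?thesis
    using nonarch_abs_mult[of "- 1" x] by simp
qed

instantiation padic_int :: (prime_card) nonarch_idom
begin

definition nonarch_abs_padic_int :: "'a padic_int \<Rightarrow> real" where
  "nonarch_abs x = (if x = 0 then 0 else (1 / real CARD('a)) ^ padic_val x)"

instance
proof
  fix x y :: "'a padic_int"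
  have p: "1 < CARD('a)"
    by (rule prime_gt_1_nat[OF prime_CARD])
  show "0 \<le> nonarch_abs x" "nonarch_abs x = 0 \<longleftrightarrow> x = 0"
    using p by (auto simp: nonarch_abs_padic_int_def)
  show "nonarch_abs (x * y) = nonarch_abs x * nonarch_abs y"
    by (simp add: nonarch_abs_padic_int_def padic_val_mult power_add)
  show "nonarch_abs (x + y) \<le> max (nonarch_abs x) (nonarch_abs y)"
  proof (cases "x = 0 \<or> y = 0 \<or> x + y = 0")
    case True
    then show ?thesis
      using p by (auto simp: nonarch_abs_padic_int_def le_max_iff_disj)
  next
    case False
    have "(1 / real CARD('a)) ^ padic_val (x + y)
        \<le> (1 / real CARD('a)) ^ min (padic_val x) (padic_val y)"
      using padic_val_add[of x y] False p by (intro power_decreasing) auto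
    then show ?thesis
      using False by (auto simp: nonarch_abs_padic_int_def min_def le_max_iff_disj split: if_splits)
  qed
qed

end

text \<open>The multiplicative extension of the absolute value to the field of fractions.\<close>

definition fract_abs :: "'a::nonarch_idom fract \<Rightarrow> real" where
  "fract_abs q = (THE r. \<exists>a b. b \<noteq> 0 \<and> q = Fract a b \<and> r = nonarch_abs a / nonarch_abs b)"

lemma fract_abs_Fract:
  fixes a b :: "'a::nonarch_idom"
  assumes "b \<noteq> 0"
  shows "fract_abs (Fract a b) = nonarch_abs a / nonarch_abs b"
  unfolding fract_abs_def
proof (rule the_equality)
  show "\<exists>c d. d \<noteq> 0 \<and> Fract a b = Fract c d
      \<and> nonarch_abs a / nonarch_abs b = nonarch_abs c / nonarch_abs d"
    using assms by blast
next
  fix r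
  assume "\<exists>c d. d \<noteq> 0 \<and> Fract a b = Fract c d \<and> r = nonarch_abs c / nonarch_abs d"
  then obtain c d where cd: "d \<noteq> 0" "a * d = c * b" "r = nonarch_abs c / nonarch_abs d"
    using assms by (auto simp: eq_fract)
  have "nonarch_abs a * nonarch_abs d = nonarch_abs c * nonarch_abs b"
    using cd(2) by (metis nonarch_abs_mult)
  moreover have "nonarch_abs b \<noteq> 0" "nonarch_abs d \<noteq> 0"
    using assms cd(1) by simp_all
  ultimately show "r = nonarch_abs a / nonarch_abs b"
    unfolding cd(3) by (metis frac_eq_eq)
qed

lemma fract_abs_eq_0_iff [simp]: "fract_abs x = 0 \<longleftrightarrow> x = 0"
  by (cases x) (simp add: fract_abs_Fract Zero_fract_def eq_fract)

lemma fract_abs_nonneg: "0 \<le> fract_abs x"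
  by (cases x) (simp add: fract_abs_Fract nonarch_abs_nonneg)

lemma fract_abs_minus [simp]: "fract_abs (- x) = fract_abs x"
  by (cases x) (simp add: fract_abs_Fract)

lemma fract_abs_mult: "fract_abs (x * y) = fract_abs x * fract_abs y"
  by (cases x; cases y) (simp add: fract_abs_Fract nonarch_abs_mult)

lemma fract_abs_add: "fract_abs (x + y) \<le> max (fract_abs x) (fract_abs y)"
proof (cases x; cases y)
  fix a b c d :: 'a
  assume xy: "x = Fract a b" "b \<noteq> 0" "y = Fract c d" "d \<noteq> 0"
  have pos: "0 < nonarch_abs b" "0 < nonarch_abs d"
    using xy nonarch_abs_nonneg[of b] nonarch_abs_nonneg[of d] by (simp_all add: less_le)
  have "nonarch_abs (a * d + c * b) / (nonarch_abs b * nonarch_abs d)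
      \<le> max (nonarch_abs (a * d)) (nonarch_abs (c * b)) / (nonarch_abs b * nonarch_abs d)"
    using pos by (intro divide_right_mono nonarch_abs_add) simp
  also have "\<dots> = max (nonarch_abs a / nonarch_abs b) (nonarch_abs c / nonarch_abs d)"
    using pos xy(2,4) by (simp add: nonarch_abs_mult max_divide_distrib_right)
  finally show ?thesis
    using xy by (simp add: fract_abs_Fract nonarch_abs_mult)
qed

instantiation fract :: (nonarch_idom) metric_space
begin

definition dist_fract :: "'a fract \<Rightarrow> 'a fract \<Rightarrow> real" where
  "dist x y = fract_abs (x - y)"

definition uniformity_fract :: "('a fract \<times> 'a fract) filter" where
  "uniformity_fract = (INF e\<in>{0<..}. principal {(x, y). dist x y < e})"

definition open_fract :: "'a fract set \<Rightarrow> bool" where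
  "open_fract U \<longleftrightarrow> (\<forall>x\<in>U. eventually (\<lambda>(x', y). x' = x \<longrightarrow> y \<in> U) uniformity)"

instance
proof
  fix x y z :: "'a fract"
  show "dist x y = 0 \<longleftrightarrow> x = y"
    by (simp add: dist_fract_def)
  have "fract_abs ((x - z) + - (y - z)) \<le> max (fract_abs (x - z)) (fract_abs (- (y - z)))"
    by (rule fract_abs_add)
  also have "\<dots> \<le> fract_abs (x - z) + fract_abs (y - z)"
    using fract_abs_nonneg[of "x - z"] fract_abs_nonneg[of "y - z"] fract_abs_minus[of "y - z"] by linarith
  finally show "dist x y \<le> dist x z + dist y z"
    by (simp add: dist_fract_def)
qed (simp_all add: uniformity_fract_def open_fract_def)

end

type_synonym 'p padic = "'p padic_int fract"

section \<open>Algebraic sets in affine space\<close>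

type_synonym ('n, 'a) mpoly = "('n \<Rightarrow>\<^sub>0 nat) \<Rightarrow>\<^sub>0 'a"

definition mpoly_eval :: "('n::finite, 'a::comm_ring_1) mpoly \<Rightarrow> 'a ^ 'n \<Rightarrow> 'a" where
  "mpoly_eval f x =
     (\<Sum>k\<in>Poly_Mapping.keys f. Poly_Mapping.lookup f k * (\<Prod>i\<in>UNIV. x $ i ^ Poly_Mapping.lookup k i))"

definition mpoly_pderiv :: "'n \<Rightarrow> ('n, 'a::comm_ring_1) mpoly \<Rightarrow> ('n, 'a) mpoly" where
  "mpoly_pderiv i f =
     (\<Sum>k\<in>Poly_Mapping.keys f.
        Poly_Mapping.single (k - Poly_Mapping.single i 1)
          (of_nat (Poly_Mapping.lookup k i) * Poly_Mapping.lookup f k))"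

text \<open>The rank of the matrix whose rows are the gradients at \<open>a\<close> of the listed polynomials
  (compare \<open>row_rank_def_gen\<close>; the number of rows varies, so it is not a matrix type).\<close>

definition jacobian_rank :: "('n::finite, 'a::field) mpoly list \<Rightarrow> 'a ^ 'n \<Rightarrow> nat" where
  "jacobian_rank fs a = vec.dim ((\<lambda>f. \<chi> i. mpoly_eval (mpoly_pderiv i f) a) ` set fs)"

definition zero_locus :: "('n::finite, 'a::comm_ring_1) mpoly set \<Rightarrow> ('a ^ 'n) set" where
  "zero_locus S = {x. \<forall>f\<in>S. mpoly_eval f x = 0}"

definition algebraic_set :: "('a::comm_ring_1 ^ 'n::finite) set \<Rightarrow> bool" where
  "algebraic_set V \<longleftrightarrow> (\<exists>S. V = zero_locus S)"

definition vanishing_ideal :: "('a::comm_ring_1 ^ 'n::finite) set \<Rightarrow> ('n, 'a) mpoly set" where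
  "vanishing_ideal V = {f. \<forall>x\<in>V. mpoly_eval f x = 0}"

lemma module_mult: "module ((*) :: 'a::comm_ring_1 \<Rightarrow> 'a \<Rightarrow> 'a)"
  by unfold_locales (simp_all add: algebra_simps)

definition ideal_generated :: "'a::comm_ring_1 set \<Rightarrow> 'a set" where
  "ideal_generated S = module.span (*) S"

text \<open>The polynomials whose image in the local ring at \<open>a\<close> lies in the extension of the ideal \<open>I\<close>
  to that local ring. An ideal of a localization is determined by its contraction, so two ideals
  generate the same ideal of the local ring at \<open>a\<close> iff these sets coincide.\<close>

definition local_ideal :: "'a ^ 'n \<Rightarrow> ('n::finite, 'a::comm_ring_1) mpoly set \<Rightarrow> ('n, 'a) mpoly set" where
  "local_ideal a I = {g. \<exists>h. mpoly_eval h a \<noteq> 0 \<and> h * g \<in> I}"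

text \<open>The condition on the length says that there are $n - d$ equations (in particular $d \le n$).\<close>

definition smooth_algebraic_set :: "nat \<Rightarrow> ('a::field ^ 'n::finite) set \<Rightarrow> bool" where
  "smooth_algebraic_set d V \<longleftrightarrow>
     algebraic_set V \<and>
     (\<forall>a\<in>V. \<exists>fs. length fs + d = CARD('n) \<and>
        local_ideal a (ideal_generated (set fs)) = local_ideal a (vanishing_ideal V) \<and>
        jacobian_rank fs a = length fs)"

section \<open>Subsets of affine space over the $p$-adic integers\<close>

definition padic_embed :: "'p::prime_card padic_int ^ 'n \<Rightarrow> 'p padic ^ 'n" where
  "padic_embed x = (\<chi> i. to_fract (x $ i))"

definition reduction :: "nat \<Rightarrow> 'p::prime_card padic_int ^ 'n \<Rightarrow> int ^ 'n" where
  "reduction m x = (\<chi> i. residue (x $ i) m)"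

definition reduction_count :: "nat \<Rightarrow> ('p::prime_card padic_int ^ 'n) set \<Rightarrow> nat" where
  "reduction_count m X = card (reduction m ` X)"

end

theory Submission
  imports Defs
begin

text \<open>Reduction modulo \<open>p ^ m\<close> maps the classes of \<open>X\<close> modulo \<open>p ^ Suc m\<close> onto those modulo
  \<open>p ^ m\<close>, so it is enough that for large \<open>m\<close> every fibre of this map has exactly \<open>p ^ d\<close>
  elements. By compactness this may be shown near one point \<open>a\<close> of \<open>X\<close>, provided that the bound
  for \<open>m\<close> works for all points of \<open>X\<close> in a ball around \<open>a\<close>.

  Near \<open>a\<close> the set \<open>X\<close> is the zero set of the $n - d$ equations that generate the ideal of \<open>V\<close>
  locally (\<open>locally_zeros_of_equations\<close>). That the common zeros of these equations lie in \<open>V\<close>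
  needs the Hilbert basis theorem: membership in the local ideal is witnessed by a denominator that
  does not vanish at \<open>a\<close>, and only finitely many denominators have a common neighbourhood on
  which they do not vanish. The equations have independent gradients, so Gaussian elimination
  replaces them by equations $g_j$, for $j$ in a set $J$ of $n - d$ coordinates, whose gradient
  at \<open>a\<close> is the unit vector $e_j$ on the coordinates in $J$. Choosing the pivots of largest
  absolute value makes the remaining entries integral (\<open>solved_equations\<close>).

  Polynomials are strictly differentiable. Hence near \<open>a\<close>, for points with
  $x \equiv y$ modulo $p^s$, the difference $g_j(x) - g_j(y)$ agrees modulo $p^{s+1}$ with the value
  on $x - y$ of the integral linear form given by the gradient of $g_j$ at \<open>a\<close>. So among the
  zeros of the $g_j$ in a given class modulo $p^m$, the coordinates outside $J$ modulo $p^{m+1}$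
  determine those in $J$. Conversely, arbitrary lifts of the $d$ coordinates outside $J$ extend to
  a zero by the iteration $x_j \mapsto x_j - g_j(x)$ in the coordinates in $J$, which converges as in
  Hensel's lemma. The fibre is thus in bijection with the $p^d$ choices of these lifts
  (\<open>card_fibre_of_solved_equations\<close>).\<close>

section \<open>Evaluation of polynomials\<close>

lemma mpoly_eval_superset:
  assumes "finite K" "Poly_Mapping.keys f \<subseteq> K"
  shows "mpoly_eval f x =
    (\<Sum>k\<in>K. Poly_Mapping.lookup f k * (\<Prod>i\<in>UNIV. x $ i ^ Poly_Mapping.lookup k i))"
  unfolding mpoly_eval_def using assms by (intro sum.mono_neutral_left) (auto simp: in_keys_iff)

lemma mpoly_eval_single [simp]:
  "mpoly_eval (Poly_Mapping.single k c) x = c * (\<Prod>i\<in>UNIV. x $ i ^ Poly_Mapping.lookup k i)"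
  by (subst mpoly_eval_superset[of "{k}"]) auto

lemma mpoly_eval_add: "mpoly_eval (f + g) x = mpoly_eval f x + mpoly_eval g x"
proof -
  let ?K = "Poly_Mapping.keys f \<union> Poly_Mapping.keys g"
  show ?thesis
    using Poly_Mapping.keys_add[of f g]
    by (simp add: mpoly_eval_superset[of ?K] lookup_add distrib_right sum.distrib)
qed

lemma mpoly_eval_0 [simp]: "mpoly_eval 0 x = 0"
  by (simp add: mpoly_eval_def)

lemma mpoly_eval_sum: "mpoly_eval (\<Sum>i\<in>A. f i) x = (\<Sum>i\<in>A. mpoly_eval (f i) x)"
  by (induction A rule: infinite_finite_induct) (simp_all add: mpoly_eval_add)

lemma mpoly_sum_monomials:
  "f = (\<Sum>k\<in>Poly_Mapping.keys f. Poly_Mapping.single k (Poly_Mapping.lookup f k))"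
proof (rule poly_mapping_eqI)
  fix k
  have "(\<Sum>l\<in>Poly_Mapping.keys f. Poly_Mapping.lookup (Poly_Mapping.single l (Poly_Mapping.lookup f l)) k)
      = (\<Sum>l\<in>Poly_Mapping.keys f. if l = k then Poly_Mapping.lookup f k else 0)"
    by (rule sum.cong) (auto simp: lookup_single)
  then show "Poly_Mapping.lookup f k = Poly_Mapping.lookup
      (\<Sum>k\<in>Poly_Mapping.keys f. Poly_Mapping.single k (Poly_Mapping.lookup f k)) k"
    by (simp add: lookup_sum in_keys_iff)
qed

lemma mpoly_eval_mult: "mpoly_eval (f * g) x = mpoly_eval f x * mpoly_eval g x"
proof -
  have "f * g = (\<Sum>k\<in>Poly_Mapping.keys f. \<Sum>l\<in>Poly_Mapping.keys g.
      Poly_Mapping.single k (Poly_Mapping.lookup f k) * Poly_Mapping.single l (Poly_Mapping.lookup g l))"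
    by (subst mpoly_sum_monomials[of f], subst mpoly_sum_monomials[of g], rule sum_product)
  then show ?thesis
    by (simp add: mpoly_eval_sum mult_single lookup_add power_add prod.distrib
        mpoly_eval_def[of f] mpoly_eval_def[of g] sum_product ac_simps)
qed

lemma mpoly_eval_1 [simp]: "mpoly_eval 1 x = 1"
  using mpoly_eval_single[of 0 1 x] by (simp flip: single_one)

lemma mpoly_eval_ideal_generated:
  assumes "f \<in> ideal_generated S" and "\<And>g. g \<in> S \<Longrightarrow> mpoly_eval g x = 0"
  shows "mpoly_eval f x = 0"
  using assms(1) unfolding ideal_generated_def
proof (induction rule: module.span_induct_alt[OF module_mult, consumes 1, case_names base step])
  case base
  show ?case by simp
next
  case (step c g h)
  then show ?case
    using assms(2) by (simp add: mpoly_eval_add mpoly_eval_mult)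
qed

lemma mpoly_eval_pderiv:
  "mpoly_eval (mpoly_pderiv l f) x =
    (\<Sum>k\<in>Poly_Mapping.keys f. Poly_Mapping.lookup f k * (of_nat (Poly_Mapping.lookup k l)
      * x $ l ^ (Poly_Mapping.lookup k l - 1) * (\<Prod>i\<in>UNIV - {l}. x $ i ^ Poly_Mapping.lookup k i)))"
  unfolding mpoly_pderiv_def mpoly_eval_sum mpoly_eval_single
proof (rule sum.cong[OF refl])
  fix k
  have "(\<Prod>i\<in>UNIV. x $ i ^ Poly_Mapping.lookup (k - Poly_Mapping.single l 1) i)
      = x $ l ^ (Poly_Mapping.lookup k l - 1)
        * (\<Prod>i\<in>UNIV - {l}. x $ i ^ Poly_Mapping.lookup (k - Poly_Mapping.single l 1) i)"
    by (subst prod.remove[of _ l]) (simp_all add: lookup_minus)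
  also have "(\<Prod>i\<in>UNIV - {l}. x $ i ^ Poly_Mapping.lookup (k - Poly_Mapping.single l 1) i)
      = (\<Prod>i\<in>UNIV - {l}. x $ i ^ Poly_Mapping.lookup k i)"
    by (rule prod.cong) (auto simp: lookup_minus lookup_single)
  finally show "of_nat (Poly_Mapping.lookup k l) * Poly_Mapping.lookup f k
        * (\<Prod>i\<in>UNIV. x $ i ^ Poly_Mapping.lookup (k - Poly_Mapping.single l 1) i)
      = Poly_Mapping.lookup f k * (of_nat (Poly_Mapping.lookup k l)
      * x $ l ^ (Poly_Mapping.lookup k l - 1) * (\<Prod>i\<in>UNIV - {l}. x $ i ^ Poly_Mapping.lookup k i))"
    by (simp add: ac_simps)
qed

section \<open>The Hilbert basis theorem\<close>

definition is_subring :: "'a::comm_ring_1 set \<Rightarrow> bool" where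
  "is_subring R \<longleftrightarrow> 1 \<in> R \<and> (\<forall>x\<in>R. \<forall>y\<in>R. x - y \<in> R \<and> x * y \<in> R)"

lemma is_subringD:
  assumes "is_subring R"
  shows "1 \<in> R" "0 \<in> R" "x \<in> R \<Longrightarrow> - x \<in> R"
    and "x \<in> R \<Longrightarrow> y \<in> R \<Longrightarrow> x - y \<in> R" "x \<in> R \<Longrightarrow> y \<in> R \<Longrightarrow> x + y \<in> R"
    and "x \<in> R \<Longrightarrow> y \<in> R \<Longrightarrow> x * y \<in> R"
proof -
  have 0: "0 \<in> R"
    using assms unfolding is_subring_def by (metis diff_self)
  have m: "- x \<in> R" if "x \<in> R" for x
    using assms 0 that unfolding is_subring_def by (metis diff_0)
  show "x + y \<in> R" if "x \<in> R" "y \<in> R"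
    using assms m[of y] that unfolding is_subring_def by (metis diff_minus_eq_add)
  show "0 \<in> R" "x \<in> R \<Longrightarrow> - x \<in> R"
    by (fact 0, fact m)
qed (use assms in \<open>auto simp: is_subring_def\<close>)

definition combinations :: "'a::comm_ring_1 set \<Rightarrow> (nat \<Rightarrow> 'a) \<Rightarrow> nat \<Rightarrow> 'a set" where
  "combinations R a N = {\<Sum>i<N. r i * a i | r. \<forall>i. r i \<in> R}"

text \<open>For a subring this says that it is a Noetherian ring. The formulation by sequences avoids
  speaking of ideals relative to a subring, and it is the form in which the ascending chain
  condition enters and leaves the proof of Hilbert's theorem.\<close>

definition noetherian :: "'a::comm_ring_1 set \<Rightarrow> bool" where
  "noetherian R \<longleftrightarrow> (\<forall>a. (\<forall>i. a i \<in> R) \<longrightarrow> (\<exists>N. a N \<in> combinations R a N))"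

context
  fixes R :: "'a::comm_ring_1 set"
  assumes R: "is_subring R"
begin

lemma subring_sum: "(\<And>i. i \<in> A \<Longrightarrow> f i \<in> R) \<Longrightarrow> sum f A \<in> R"
  by (induction A rule: infinite_finite_induct) (auto intro: is_subringD[OF R])

lemma combinations_0: "0 \<in> combinations R a N"
  unfolding combinations_def using is_subringD(2)[OF R] by (auto intro!: exI[of _ "\<lambda>_. 0"])

lemma combinations_add:
  assumes "x \<in> combinations R a N" "y \<in> combinations R a N"
  shows "x + y \<in> combinations R a N"
proof -
  obtain r s where rs: "\<And>i. r i \<in> R" "x = (\<Sum>i<N. r i * a i)" "\<And>i. s i \<in> R" "y = (\<Sum>i<N. s i * a i)"
    using assms by (auto simp: combinations_def)
  then show ?thesis
    using is_subringD(5)[OF R] unfolding combinations_def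
    by (intro CollectI exI[of _ "\<lambda>i. r i + s i"]) (simp add: distrib_right sum.distrib)
qed

lemma combinations_mult:
  assumes "c \<in> R" "x \<in> combinations R a N"
  shows "c * x \<in> combinations R a N"
proof -
  obtain r where r: "\<And>i. r i \<in> R" "x = (\<Sum>i<N. r i * a i)"
    using assms by (auto simp: combinations_def)
  then show ?thesis
    using is_subringD(6)[OF R assms(1)] unfolding combinations_def
    by (intro CollectI exI[of _ "\<lambda>i. c * r i"]) (simp add: sum_distrib_left mult.assoc)
qed

lemma combinations_uminus: "x \<in> combinations R a N \<Longrightarrow> - x \<in> combinations R a N"
  using combinations_mult[of "- 1" x] is_subringD[OF R] by simp

lemma combinations_sum:
  "(\<And>i. i \<in> A \<Longrightarrow> f i \<in> combinations R a N) \<Longrightarrow> sum f A \<in> combinations R a N"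
  by (induction A rule: infinite_finite_induct) (auto intro: combinations_add combinations_0)

lemma combinations_base:
  assumes "i < N"
  shows "a i \<in> combinations R a N"
proof -
  have "(\<Sum>j<N. (if j = i then 1 else 0) * a j) = (\<Sum>j<N. if j = i then a j else 0)"
    by (rule sum.cong) auto
  then show ?thesis
    using assms is_subringD[OF R] unfolding combinations_def
    by (intro CollectI exI[of _ "\<lambda>j. if j = i then 1 else 0"]) simp
qed

lemma combinations_subset:
  assumes "\<And>i. i < N \<Longrightarrow> b i \<in> combinations R a M"
  shows "combinations R b N \<subseteq> combinations R a M"
  using assms by (auto simp: combinations_def[of R b] intro!: combinations_sum combinations_mult)

lemma combinations_mono: "N \<le> M \<Longrightarrow> combinations R a N \<subseteq> combinations R a M"
  by (rule combinations_subset) (auto intro: combinations_base)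

end

text \<open>The polynomials in \<open>x\<close> of degree less than \<open>e\<close>. As \<open>x\<close> may satisfy relations over \<open>R\<close>,
  a ring element has degree bounds rather than a degree; this makes the notion apply to any element
  of the ambient ring.\<close>

definition adjoin_below :: "'a::comm_ring_1 set \<Rightarrow> 'a \<Rightarrow> nat \<Rightarrow> 'a set" where
  "adjoin_below R x e = combinations R (\<lambda>i. x ^ i) e"

definition adjoin :: "'a::comm_ring_1 set \<Rightarrow> 'a \<Rightarrow> 'a set" where
  "adjoin R x = (\<Union>e. adjoin_below R x e)"

context
  fixes R :: "'a::comm_ring_1 set" and x :: 'a
  assumes R: "is_subring R"
begin

lemma adjoin_below_power_mult:
  assumes "f \<in> adjoin_below R x e"
  shows "x ^ s * f \<in> adjoin_below R x (e + s)"
proof -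
  obtain r where r: "\<And>i. r i \<in> R" "f = (\<Sum>i<e. r i * x ^ i)"
    using assms by (auto simp: adjoin_below_def combinations_def)
  have "x ^ s * f = (\<Sum>i<e. r i * x ^ (i + s))"
    unfolding r by (simp add: sum_distrib_left power_add ac_simps)
  also have "\<dots> \<in> adjoin_below R x (e + s)"
    unfolding adjoin_below_def
    by (intro combinations_sum[OF R] combinations_mult[OF R] r combinations_base[OF R]) auto
  finally show ?thesis .
qed

lemma adjoin_add:
  assumes "f \<in> adjoin R x" "g \<in> adjoin R x"
  shows "f + g \<in> adjoin R x"
proof -
  obtain d e where "f \<in> adjoin_below R x d" "g \<in> adjoin_below R x e"
    using assms by (auto simp: adjoin_def)
  then have "f \<in> adjoin_below R x (max d e)" "g \<in> adjoin_below R x (max d e)"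
    unfolding adjoin_below_def
    by (meson combinations_mono[OF R] max.cobounded1 max.cobounded2 subsetD)+
  then have "f + g \<in> adjoin_below R x (max d e)"
    unfolding adjoin_below_def by (rule combinations_add[OF R])
  then show ?thesis
    by (auto simp: adjoin_def)
qed

lemma adjoin_0: "0 \<in> adjoin R x"
  using combinations_0[OF R] by (auto simp: adjoin_def adjoin_below_def)

lemma adjoin_sum: "(\<And>i. i \<in> A \<Longrightarrow> f i \<in> adjoin R x) \<Longrightarrow> sum f A \<in> adjoin R x"
  by (induction A rule: infinite_finite_induct) (auto intro: adjoin_add adjoin_0)

lemma adjoin_monomial: "r \<in> R \<Longrightarrow> r * x ^ i \<in> adjoin R x"
  unfolding adjoin_def adjoin_below_def
  by (auto intro!: exI[of _ "Suc i"] combinations_mult[OF R] combinations_base[OF R, of i "Suc i" "\<lambda>i. x ^ i"])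

lemma adjoin_mult:
  assumes "f \<in> adjoin R x" "g \<in> adjoin R x"
  shows "f * g \<in> adjoin R x"
proof -
  obtain d r where r: "\<And>i. r i \<in> R" "f = (\<Sum>i<d. r i * x ^ i)"
    using assms(1) by (auto simp: adjoin_def adjoin_below_def combinations_def)
  obtain e s where s: "\<And>i. s i \<in> R" "g = (\<Sum>i<e. s i * x ^ i)"
    using assms(2) by (auto simp: adjoin_def adjoin_below_def combinations_def)
  note rs = r s
  have "f * g = (\<Sum>i<d. \<Sum>j<e. (r i * s j) * x ^ (i + j))"
    unfolding rs by (simp add: sum_product power_add ac_simps)
  then show ?thesis
    using is_subringD(6)[OF R] rs by (auto intro!: adjoin_sum adjoin_monomial)
qed

lemma subset_adjoin: "R \<subseteq> adjoin R x"
  using adjoin_monomial[of _ 0] by auto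

lemma in_adjoin: "x \<in> adjoin R x"
  using adjoin_monomial[of 1 1] is_subringD[OF R] by auto

lemma is_subring_adjoin: "is_subring (adjoin R x)"
proof -
  have "- 1 \<in> adjoin R x"
    using subset_adjoin is_subringD[OF R] by blast
  then have "f - g \<in> adjoin R x" if "f \<in> adjoin R x" "g \<in> adjoin R x" for f g
    using adjoin_add[of f "- 1 * g"] adjoin_mult[of "- 1" g] that by simp
  then show ?thesis
    using adjoin_mult subset_adjoin is_subringD[OF R] by (auto simp: is_subring_def)
qed

lemma adjoin_below_Suc_split:
  assumes "f \<in> adjoin_below R x (Suc e)"
  shows "\<exists>b\<in>R. f - b * x ^ e \<in> adjoin_below R x e"
proof -
  obtain r where "\<forall>i. r i \<in> R" "f = (\<Sum>i<Suc e. r i * x ^ i)"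
    using assms by (auto simp: adjoin_below_def combinations_def)
  then show ?thesis
    by (intro bexI[of _ "r e"]) (auto simp: adjoin_below_def combinations_def)
qed

text \<open>Hilbert's argument by contradiction: from an ideal that is not finitely generated choose
  elements of least degree outside the ideal generated by the earlier ones. Their leading
  coefficients lie in \<open>R\<close>, so one of them is a combination of the earlier ones, and the same
  combination of the polynomials cancels a leading term, which contradicts the choice.\<close>

theorem noetherian_adjoin:
  assumes noeth: "noetherian R"
  shows "noetherian (adjoin R x)"
proof (rule ccontr)
  let ?S = "adjoin R x"
  note S = is_subring_adjoin
  assume "\<not> noetherian ?S"
  then obtain a where a: "\<And>i. a i \<in> ?S" "\<And>N. a N \<notin> combinations ?S a N"
    by (auto simp: noetherian_def)
  define I where "I = (\<Union>N. combinations ?S a N)"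
  \<comment> \<open>One more than the least degree of a polynomial in \<open>x\<close> with value \<open>f\<close>, and 0 for \<open>f = 0\<close>.\<close>
  define level where "level f = (LEAST e. f \<in> adjoin_below R x e)" for f
  have level: "f \<in> adjoin_below R x (level f)" if "f \<in> ?S" for f
    unfolding level_def using that by (auto simp: adjoin_def intro: LeastI)
  have I_add: "f + g \<in> I" if fg: "f \<in> I" "g \<in> I" for f g
  proof -
    obtain M N where "f \<in> combinations ?S a M" "g \<in> combinations ?S a N"
      using fg by (auto simp: I_def)
    then have "f \<in> combinations ?S a (max M N)" "g \<in> combinations ?S a (max M N)"
      by (meson combinations_mono[OF S] max.cobounded1 max.cobounded2 subsetD)+
    then have "f + g \<in> combinations ?S a (max M N)"
      by (rule combinations_add[OF S])
    then show ?thesis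
      by (auto simp: I_def)
  qed
  have I_mult: "c * f \<in> I" if "c \<in> ?S" "f \<in> I" for c f
    using that combinations_mult[OF S, of c f a] unfolding I_def by blast
  have I_0: "0 \<in> I"
    using combinations_0[OF S] by (auto simp: I_def)
  have I_sum: "sum f A \<in> I" if "\<And>i. i \<in> A \<Longrightarrow> f i \<in> I" for f :: "nat \<Rightarrow> 'a" and A
    using that by (induction A rule: infinite_finite_induct) (auto intro: I_add I_0)
  have I_S: "I \<subseteq> ?S"
    by (auto simp: I_def combinations_def intro!: adjoin_sum adjoin_mult a)
  \<comment> \<open>Since \<open>I\<close> is not finitely generated, elements of least degree outside the ideal generated by
    the earlier ones can be chosen forever.\<close>
  have "\<exists>f. \<forall>n. f n \<in> I - combinations ?S f n
      \<and> (\<forall>g\<in>I - combinations ?S f n. level (f n) \<le> level g)"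
  proof (rule dependent_wellorder_choice[where P = "\<lambda>f n r. r \<in> I - combinations ?S f n
      \<and> (\<forall>g\<in>I - combinations ?S f n. level r \<le> level g)"])
    fix r n and f g :: "nat \<Rightarrow> 'a"
    assume "\<And>i. i < n \<Longrightarrow> f i = g i"
    then have "combinations ?S f n = combinations ?S g n"
      by (simp add: combinations_def)
    then show "(r \<in> I - combinations ?S f n \<and> (\<forall>g\<in>I - combinations ?S f n. level r \<le> level g))
        = (r \<in> I - combinations ?S g n \<and> (\<forall>h\<in>I - combinations ?S g n. level r \<le> level h))"
      by simp
  next
    fix n and f :: "nat \<Rightarrow> 'a"
    assume "\<And>i. i < n \<Longrightarrow> f i \<in> I - combinations ?S f i
        \<and> (\<forall>g\<in>I - combinations ?S f i. level (f i) \<le> level g)"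
    then have "\<forall>i\<in>{..<n}. \<exists>M. f i \<in> combinations ?S a M"
      by (auto simp: I_def)
    then obtain M where M: "\<And>i. i < n \<Longrightarrow> f i \<in> combinations ?S a (M i)"
      by (metis lessThan_iff)
    define L where "L = (\<Sum>i<n. M i)"
    have "M i \<le> L" if "i < n" for i
      unfolding L_def using that by (intro member_le_sum) auto
    then have "combinations ?S f n \<subseteq> combinations ?S a L"
      by (intro combinations_subset[OF S]) (use M combinations_mono[OF S] in blast)
    moreover have "a L \<in> I"
      using combinations_base[OF S, of L "Suc L" a] by (auto simp: I_def)
    ultimately have "a L \<in> I - combinations ?S f n"
      using a(2) by blast
    then show "\<exists>r. r \<in> I - combinations ?S f n \<and> (\<forall>g\<in>I - combinations ?S f n. level r \<le> level g)"
      using ex_has_least_nat[of "\<lambda>r. r \<in> I - combinations ?S f n" "a L" level] by blast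
  qed
  then obtain f where f: "\<And>n. f n \<in> I" "\<And>n. f n \<notin> combinations ?S f n"
    "\<And>n g. g \<in> I \<Longrightarrow> g \<notin> combinations ?S f n \<Longrightarrow> level (f n) \<le> level g"
    by blast
  have pos: "0 < level (f n)" for n
  proof (rule ccontr)
    assume "\<not> 0 < level (f n)"
    then have "f n = 0"
      using level[of "f n"] f(1)[of n] I_S by (auto simp: adjoin_below_def combinations_def)
    then show False
      using f(2)[of n] combinations_0[OF S] by metis
  qed
  have mono: "level (f k) \<le> level (f n)" if "k \<le> n" for k n
    using combinations_mono[OF S that, of f] f by blast
  have "\<exists>b\<in>R. f n - b * x ^ (level (f n) - 1) \<in> adjoin_below R x (level (f n) - 1)" for n
    using adjoin_below_Suc_split[of "f n" "level (f n) - 1"] level[of "f n"] f(1)[of n] I_S pos[of n]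
    by auto
  then obtain b where b: "\<And>n. b n \<in> R"
    "\<And>n. f n - b n * x ^ (level (f n) - 1) \<in> adjoin_below R x (level (f n) - 1)"
    by metis
  have "\<exists>N. b N \<in> combinations R b N"
    using noeth b(1) by (simp add: noetherian_def)
  then obtain N r where r: "\<And>i. r i \<in> R" "b N = (\<Sum>i<N. r i * b i)"
    by (auto simp: combinations_def)
  \<comment> \<open>Cancelling the leading term of \<open>f N\<close> produces an element of smaller degree outside the ideal.\<close>
  define h where "h = (\<Sum>i<N. r i * x ^ (level (f N) - level (f i)) * f i)"
  have rS: "r i * x ^ j \<in> ?S" for i j
    by (rule adjoin_monomial) (rule r)
  have hc: "h \<in> combinations ?S f N"
    unfolding h_def by (intro combinations_sum[OF S] combinations_mult[OF S] rS combinations_base[OF S]) auto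
  have "h \<in> I"
    unfolding h_def by (intro I_sum I_mult rS f)
  then have "f N - h \<in> I"
    using I_add[OF f(1)[of N] I_mult[of "- 1" h]] is_subringD[OF S] by simp
  moreover have "f N - h \<notin> combinations ?S f N"
    using combinations_add[OF S _ hc, of "f N - h"] f(2)[of N] by auto
  ultimately have "level (f N) \<le> level (f N - h)"
    by (rule f(3))
  moreover have "f N - h \<in> adjoin_below R x (level (f N) - 1)"
  proof -
    have "r i * (x ^ (level (f N) - level (f i)) * (f i - b i * x ^ (level (f i) - 1)))
        \<in> adjoin_below R x (level (f N) - 1)" if "i < N" for i
      using adjoin_below_power_mult[OF b(2)[of i], of "level (f N) - level (f i)"] mono[of i N] that pos[of i] r(1)[of i]
      unfolding adjoin_below_def by (intro combinations_mult[OF R r(1)]) simp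
    moreover have "r i * (x ^ (level (f N) - level (f i)) * (f i - b i * x ^ (level (f i) - 1)))
        = r i * x ^ (level (f N) - level (f i)) * f i - r i * b i * x ^ (level (f N) - 1)" if "i < N" for i
    proof -
      have "level (f N) - 1 = (level (f N) - level (f i)) + (level (f i) - 1)"
        using mono[of i N] that pos[of i] by simp
      then have "x ^ (level (f N) - 1) = x ^ (level (f N) - level (f i)) * x ^ (level (f i) - 1)"
        by (simp only: power_add)
      then show ?thesis
        by (simp add: algebra_simps)
    qed
    ultimately have "(\<Sum>i<N. r i * x ^ (level (f N) - level (f i)) * f i - r i * b i * x ^ (level (f N) - 1))
        \<in> adjoin_below R x (level (f N) - 1)"
      unfolding adjoin_below_def by (intro combinations_sum[OF R]) auto
    also have "(\<Sum>i<N. r i * x ^ (level (f N) - level (f i)) * f i - r i * b i * x ^ (level (f N) - 1))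
        = h - b N * x ^ (level (f N) - 1)"
      unfolding h_def r(2) by (simp add: sum_subtractf sum_distrib_right)
    finally have "f N - b N * x ^ (level (f N) - 1) + - (h - b N * x ^ (level (f N) - 1))
        \<in> adjoin_below R x (level (f N) - 1)"
      using b(2)[of N] unfolding adjoin_below_def
      by (intro combinations_add[OF R] combinations_uminus[OF R])
    then show ?thesis
      by simp
  qed
  then have "level (f N - h) \<le> level (f N) - 1"
    unfolding level_def[of "f N - h"] by (rule Least_le)
  ultimately show False
    using pos[of N] by simp
qed

end

lemma noetherian_constants:
  shows "is_subring (range (Poly_Mapping.single (0 :: 'n \<Rightarrow>\<^sub>0 nat) :: 'a::field \<Rightarrow> ('n, 'a) mpoly))"
    and "noetherian (range (Poly_Mapping.single (0 :: 'n \<Rightarrow>\<^sub>0 nat) :: 'a::field \<Rightarrow> ('n, 'a) mpoly))"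
proof -
  let ?C = "Poly_Mapping.single (0 :: 'n \<Rightarrow>\<^sub>0 nat) :: 'a \<Rightarrow> ('n, 'a) mpoly"
  show R: "is_subring (range ?C)"
    unfolding is_subring_def by (force simp: mult_single simp flip: single_diff single_one)
  show "noetherian (range ?C)"
    unfolding noetherian_def
  proof (intro allI impI)
    fix a :: "nat \<Rightarrow> ('n, 'a) mpoly"
    assume a: "\<forall>i. a i \<in> range ?C"
    then obtain c d where cd: "a 0 = ?C c" "a 1 = ?C d"
      by blast
    show "\<exists>N. a N \<in> combinations (range ?C) a N"
    proof (cases "c = 0")
      case True
      then have "a 0 \<in> combinations (range ?C) a 0"
        using cd combinations_0[OF R] by simp
      then show ?thesis ..
    next
      case False
      have "?C (d / c) * a 0 \<in> combinations (range ?C) a 1"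
        by (intro combinations_mult[OF R] combinations_base[OF R]) auto
      then have "a 1 \<in> combinations (range ?C) a 1"
        using False cd by (simp add: mult_single)
      then show ?thesis ..
    qed
  qed
qed

text \<open>Adjoin the variables one at a time to the constants. All rings in this chain are subrings of
  one ring of polynomials, since the number of variables is part of the type.\<close>

theorem Hilbert_basis: "noetherian (UNIV :: ('n::finite, 'a::field) mpoly set)"
proof -
  let ?C = "Poly_Mapping.single (0 :: 'n \<Rightarrow>\<^sub>0 nat) :: 'a \<Rightarrow> ('n, 'a) mpoly"
  let ?X = "\<lambda>i. Poly_Mapping.single (Poly_Mapping.single i 1) 1 :: ('n, 'a) mpoly"
  have "\<exists>R. is_subring R \<and> noetherian R \<and> range ?C \<subseteq> R \<and> ?X ` A \<subseteq> R" if "finite A" for A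
    using that
  proof (induction A rule: finite_induct)
    case empty
    show ?case
      using noetherian_constants by (intro exI[of _ "range ?C"]) simp
  next
    case (insert i A)
    then obtain R where "is_subring R" "noetherian R" "range ?C \<subseteq> R" "?X ` A \<subseteq> R"
      by blast
    then show ?case
      using is_subring_adjoin[of R "?X i"] noetherian_adjoin[of R "?X i"] subset_adjoin[of R "?X i"]
        in_adjoin[of R "?X i"]
      by (intro exI[of _ "adjoin R (?X i)"]) auto
  qed
  from this[of UNIV] obtain R where R: "is_subring R" "noetherian R" "range ?C \<subseteq> R" "range ?X \<subseteq> R"
    by auto
  have mon: "Poly_Mapping.single k c \<in> R" for k c
  proof -
    have pow: "Poly_Mapping.single (Poly_Mapping.single i j) 1 \<in> R" for i j
    proof (induction j)
      case 0
      show ?case using is_subringD(1)[OF R(1)] by simp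
    next
      case (Suc j)
      have "Poly_Mapping.single (Poly_Mapping.single i (Suc j)) 1
          = ?X i * Poly_Mapping.single (Poly_Mapping.single i j) 1"
        by (simp add: mult_single flip: single_add)
      then show ?case
        using Suc R(4) is_subringD(6)[OF R(1)] by auto
    qed
    have "Poly_Mapping.single (\<Sum>i\<in>A. Poly_Mapping.single i (Poly_Mapping.lookup k i)) c \<in> R"
      if "finite A" for A
      using that
    proof (induction A rule: finite_induct)
      case empty
      show ?case using R(3) by auto
    next
      case (insert i A)
      have "Poly_Mapping.single (\<Sum>i\<in>insert i A. Poly_Mapping.single i (Poly_Mapping.lookup k i)) c
         = Poly_Mapping.single (Poly_Mapping.single i (Poly_Mapping.lookup k i)) 1
           * Poly_Mapping.single (\<Sum>i\<in>A. Poly_Mapping.single i (Poly_Mapping.lookup k i)) c"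
        using insert by (simp add: mult_single)
      then show ?case
        using insert pow is_subringD(6)[OF R(1)] by auto
    qed
    \<comment> \<open>The decomposition of a polynomial into monomials, read for the exponent \<open>k\<close>.\<close>
    moreover have "(\<Sum>i\<in>Poly_Mapping.keys k. Poly_Mapping.single i (Poly_Mapping.lookup k i)) = k"
      by (rule mpoly_sum_monomials[symmetric])
    ultimately show ?thesis
      by (metis finite_keys)
  qed
  have "f \<in> R" for f
    by (subst mpoly_sum_monomials) (intro subring_sum[OF R(1)] mon)
  then have "R = UNIV"
    by blast
  then show ?thesis
    using R(2) by simp
qed

text \<open>Otherwise there would be a sequence of polynomials none of which vanishes on all common zeros
  of the earlier ones, although some member of it is a combination of earlier ones.\<close>

corollary zero_locus_finite:
  fixes S :: "('n::finite, 'a::field) mpoly set"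
  shows "\<exists>T\<subseteq>S. finite T \<and> zero_locus T = zero_locus S"
proof (rule ccontr)
  assume *: "\<not> ?thesis"
  have "\<exists>s. \<forall>n::nat. s n \<in> S \<and> \<not> zero_locus (s ` {..<n}) \<subseteq> zero_locus {s n}"
  proof (rule dependent_wellorder_choice[where
        P = "\<lambda>s (n :: nat) r. r \<in> S \<and> \<not> zero_locus (s ` {..<n}) \<subseteq> zero_locus {r}"])
    fix r n and s t :: "nat \<Rightarrow> ('n, 'a) mpoly"
    assume "\<And>i. i < n \<Longrightarrow> s i = t i"
    then have "s ` {..<n} = t ` {..<n}"
      by auto
    then show "(r \<in> S \<and> \<not> zero_locus (s ` {..<n}) \<subseteq> zero_locus {r})
        = (r \<in> S \<and> \<not> zero_locus (t ` {..<n}) \<subseteq> zero_locus {r})"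
      by simp
  next
    fix n and s :: "nat \<Rightarrow> ('n, 'a) mpoly"
    assume "\<And>i. i < n \<Longrightarrow> s i \<in> S \<and> \<not> zero_locus (s ` {..<i}) \<subseteq> zero_locus {s i}"
    then have "s ` {..<n} \<subseteq> S"
      by auto
    then have "zero_locus (s ` {..<n}) \<noteq> zero_locus S"
      using * by blast
    moreover have "zero_locus S \<subseteq> zero_locus (s ` {..<n})"
      using \<open>s ` {..<n} \<subseteq> S\<close> unfolding zero_locus_def by blast
    ultimately show "\<exists>r. r \<in> S \<and> \<not> zero_locus (s ` {..<n}) \<subseteq> zero_locus {r}"
      by (fastforce simp: zero_locus_def)
  qed
  then obtain s :: "nat \<Rightarrow> ('n, 'a) mpoly"
    where s: "\<And>n. \<not> zero_locus (s ` {..<n}) \<subseteq> zero_locus {s n}"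
    by blast
  have "\<exists>N. s N \<in> combinations UNIV s N"
    using Hilbert_basis[where 'n = 'n and 'a = 'a] unfolding noetherian_def by blast
  then obtain N r where "s N = (\<Sum>i<N. r i * s i)"
    by (auto simp: combinations_def)
  then have "zero_locus (s ` {..<N}) \<subseteq> zero_locus {s N}"
    by (auto simp: zero_locus_def mpoly_eval_sum mpoly_eval_mult)
  then show False
    using s by blast
qed

section \<open>Strictly differentiable functions\<close>

instance fract :: (nonarch_idom) topological_ab_group_add
proof
  fix a b :: "'a fract"
  have "(((\<lambda>z. dist (fst z) a + dist (snd z) b) \<longlongrightarrow> dist a a + dist b b) (nhds a \<times>\<^sub>F nhds b))"
    unfolding nhds_prod[symmetric]
    by (intro tendsto_intros) (simp_all add: nhds_prod filterlim_fst filterlim_snd)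
  then have lim: "((\<lambda>z. dist (fst z) a + dist (snd z) b) \<longlongrightarrow> 0) (nhds a \<times>\<^sub>F nhds b)"
    by simp
  have bound: "dist (x + y) (a + b) \<le> dist x a + dist y b" for x y
  proof -
    have "fract_abs ((x - a) + (y - b)) \<le> max (fract_abs (x - a)) (fract_abs (y - b))"
      by (rule fract_abs_add)
    then show ?thesis
      using fract_abs_nonneg[of "x - a"] fract_abs_nonneg[of "y - b"]
      by (simp add: dist_fract_def algebra_simps)
  qed
  have "\<forall>z. norm (dist (fst z + snd z) (a + b))
      \<le> dist (fst z) a + dist (snd z) b"
    using bound by simp
  then show "LIM z nhds a \<times>\<^sub>F nhds b. fst z + snd z :> nhds (a + b)"
    unfolding tendsto_dist_iff[of "\<lambda>z. fst z + snd z"]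
    by (rule Lim_null_comparison[OF always_eventually lim])
  show "(uminus \<longlongrightarrow> - a) (nhds a)"
  proof -
    have "dist (- x) (- a) = dist x a" for x
      using fract_abs_minus[of "x - a"] by (simp add: dist_fract_def)
    moreover have "((\<lambda>x. dist x a) \<longlongrightarrow> dist a a) (nhds a)"
      by (intro tendsto_intros) (simp add: filterlim_ident)
    ultimately show ?thesis
      by (subst tendsto_dist_iff) simp
  qed
qed

instance fract :: (nonarch_idom) topological_semigroup_mult
proof
  fix a b :: "'a fract"
  have "((\<lambda>z. dist (fst z) a * dist (snd z) b + fract_abs a * dist (snd z) b + dist (fst z) a * fract_abs b)
      \<longlongrightarrow> dist a a * dist b b + fract_abs a * dist b b + dist a a * fract_abs b) (nhds a \<times>\<^sub>F nhds b)"
    by (intro tendsto_intros) (simp_all add: filterlim_fst filterlim_snd)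
  then have lim: "((\<lambda>z. dist (fst z) a * dist (snd z) b + fract_abs a * dist (snd z) b + dist (fst z) a * fract_abs b)
      \<longlongrightarrow> 0) (nhds a \<times>\<^sub>F nhds b)"
    by simp
  have bound: "dist (x * y) (a * b) \<le> dist x a * dist y b + fract_abs a * dist y b + dist x a * fract_abs b"
    for x y
  proof -
    have tri: "fract_abs (u + v) \<le> fract_abs u + fract_abs v" for u v :: "'a fract"
      using fract_abs_add[of u v] fract_abs_nonneg[of u] fract_abs_nonneg[of v] by simp
    have "x * y - a * b = (x - a) * (y - b) + a * (y - b) + (x - a) * b"
      by (simp add: algebra_simps)
    then have "fract_abs (x * y - a * b)
        \<le> fract_abs ((x - a) * (y - b)) + fract_abs (a * (y - b)) + fract_abs ((x - a) * b)"
      using tri[of "(x - a) * (y - b) + a * (y - b)" "(x - a) * b"] tri[of "(x - a) * (y - b)" "a * (y - b)"]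
      by simp
    then show ?thesis
      by (simp add: dist_fract_def fract_abs_mult)
  qed
  have "\<forall>z. norm (dist (fst z * snd z) (a * b))
      \<le> dist (fst z) a * dist (snd z) b + fract_abs a * dist (snd z) b + dist (fst z) a * fract_abs b"
    using bound by simp
  then show "LIM z nhds a \<times>\<^sub>F nhds b. fst z * snd z :> nhds (a * b)"
    unfolding tendsto_dist_iff[of "\<lambda>z. fst z * snd z"]
    by (rule Lim_null_comparison[OF always_eventually lim])
qed

text \<open>Strict differentiability in the form of Caratheodory: the increment of \<open>f\<close> is a linear form in
  \<open>x - y\<close> whose coefficients are functions of both points that converge to the gradient as both
  points approach \<open>a\<close>. Differentiability at \<open>a\<close> alone would not control \<open>f x - f y\<close> for two
  points that are much closer to each other than to \<open>a\<close>. With this definition the calculus rules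
  are algebraic identities and limit rules.\<close>

definition strict_gradient ::
    "('a::{comm_ring_1, topological_ab_group_add, topological_semigroup_mult} ^ 'n::finite \<Rightarrow> 'a)
      \<Rightarrow> 'a ^ 'n \<Rightarrow> 'a ^ 'n \<Rightarrow> bool" where
  "strict_gradient f a v \<longleftrightarrow>
    (\<exists>q. (\<forall>x y. f x - f y = (\<Sum>i\<in>UNIV. q i (x, y) * (x $ i - y $ i))) \<and>
         (\<forall>i. (q i \<longlongrightarrow> v $ i) (nhds (a, a))))"

lemma strict_gradientI:
  assumes "\<And>x y. f x - f y = (\<Sum>i\<in>UNIV. q i (x, y) * (x $ i - y $ i))"
    and "\<And>i. (q i \<longlongrightarrow> v $ i) (nhds (a, a))"
  shows "strict_gradient f a v"
  using assms unfolding strict_gradient_def by blast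

lemma tendsto_fst_nhds: "(fst \<longlongrightarrow> a) (nhds (a, b))"
  and tendsto_snd_nhds: "(snd \<longlongrightarrow> b) (nhds (a, b))"
  by (simp_all add: nhds_prod filterlim_fst filterlim_snd)

lemma strict_gradient_continuous:
  assumes "strict_gradient f a v"
  shows "(f \<longlongrightarrow> f a) (nhds a)"
proof -
  obtain q where q: "\<And>x y. f x - f y = (\<Sum>i\<in>UNIV. q i (x, y) * (x $ i - y $ i))"
      "\<And>i. (q i \<longlongrightarrow> v $ i) (nhds (a, a))"
    using assms by (auto simp: strict_gradient_def)
  have "((\<lambda>x. (x, a)) \<longlongrightarrow> (a, a)) (nhds a)"
    by (intro tendsto_intros) (simp add: filterlim_ident)
  then have "((\<lambda>x. q i (x, a)) \<longlongrightarrow> v $ i) (nhds a)" for i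
    by (rule filterlim_compose[OF q(2)])
  then have "((\<lambda>x. f a + (\<Sum>i\<in>UNIV. q i (x, a) * (x $ i - a $ i))) \<longlongrightarrow>
      f a + (\<Sum>i\<in>UNIV. v $ i * (a $ i - a $ i))) (nhds a)"
    by (intro tendsto_intros) (simp_all add: filterlim_ident)
  moreover have "f a + (\<Sum>i\<in>UNIV. q i (x, a) * (x $ i - a $ i)) = f x" for x
    using q(1)[of x a] by (simp add: algebra_simps)
  ultimately show ?thesis
    by simp
qed

lemma strict_gradient_const: "strict_gradient (\<lambda>_. c) a 0"
  by (rule strict_gradientI[of _ "\<lambda>_ _. 0"]) simp_all

lemma strict_gradient_coordinate: "strict_gradient (\<lambda>x. x $ j) a (\<chi> i. if i = j then 1 else 0)"
proof (rule strict_gradientI[of _ "\<lambda>i _. if i = j then 1 else 0"])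
  fix x y :: "'a ^ 'b"
  have "(\<Sum>i\<in>UNIV. (if i = j then 1 else 0) * (x $ i - y $ i))
      = (\<Sum>i\<in>UNIV. if i = j then x $ i - y $ i else 0)"
    by (rule sum.cong) auto
  then show "x $ j - y $ j = (\<Sum>i\<in>UNIV. (if i = j then 1 else 0) * (x $ i - y $ i))"
    by simp
qed simp

lemma strict_gradient_add:
  assumes "strict_gradient f a v" "strict_gradient g a w"
  shows "strict_gradient (\<lambda>x. f x + g x) a (v + w)"
proof -
  obtain q r where "\<And>x y. f x - f y = (\<Sum>i\<in>UNIV. q i (x, y) * (x $ i - y $ i))"
      "\<And>i. (q i \<longlongrightarrow> v $ i) (nhds (a, a))"
      "\<And>x y. g x - g y = (\<Sum>i\<in>UNIV. r i (x, y) * (x $ i - y $ i))"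
      "\<And>i. (r i \<longlongrightarrow> w $ i) (nhds (a, a))"
    using assms unfolding strict_gradient_def by blast
  then show ?thesis
    by (intro strict_gradientI[of _ "\<lambda>i z. q i z + r i z"])
      (auto simp: add_diff_add distrib_right sum.distrib intro!: tendsto_intros)
qed

lemma strict_gradient_mult:
  assumes f: "strict_gradient f a v" and g: "strict_gradient g a w"
  shows "strict_gradient (\<lambda>x. f x * g x) a (f a *s w + g a *s v)"
proof -
  obtain q r where qr: "\<And>x y. f x - f y = (\<Sum>i\<in>UNIV. q i (x, y) * (x $ i - y $ i))"
      "\<And>i. (q i \<longlongrightarrow> v $ i) (nhds (a, a))"
      "\<And>x y. g x - g y = (\<Sum>i\<in>UNIV. r i (x, y) * (x $ i - y $ i))"
      "\<And>i. (r i \<longlongrightarrow> w $ i) (nhds (a, a))"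
    using assms unfolding strict_gradient_def by blast
  show ?thesis
  proof (rule strict_gradientI[of _ "\<lambda>i z. f (fst z) * r i z + g (snd z) * q i z"])
    fix x y
    have "f x * g x - f y * g y = f x * (g x - g y) + g y * (f x - f y)"
      by (simp add: algebra_simps)
    then show "f x * g x - f y * g y = (\<Sum>i\<in>UNIV.
        (f (fst (x, y)) * r i (x, y) + g (snd (x, y)) * q i (x, y)) * (x $ i - y $ i))"
      by (simp add: qr distrib_right sum.distrib sum_distrib_left mult.assoc)
  next
    have "((\<lambda>z. f (fst z)) \<longlongrightarrow> f a) (nhds (a, a))" "((\<lambda>z. g (snd z)) \<longlongrightarrow> g a) (nhds (a, a))"
      by (rule filterlim_compose[OF strict_gradient_continuous[OF f] tendsto_fst_nhds])
        (rule filterlim_compose[OF strict_gradient_continuous[OF g] tendsto_snd_nhds])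
    then show "((\<lambda>z. f (fst z) * r i z + g (snd z) * q i z) \<longlongrightarrow> (f a *s w + g a *s v) $ i) (nhds (a, a))" for i
      by (auto intro!: tendsto_intros qr)
  qed
qed

lemma strict_gradient_scale: "strict_gradient f a v \<Longrightarrow> strict_gradient (\<lambda>x. c * f x) a (c *s v)"
  using strict_gradient_mult[OF strict_gradient_const[of c a], of f v] by simp

lemma strict_gradient_sum:
  assumes "\<And>k. k \<in> K \<Longrightarrow> strict_gradient (f k) a (v k)"
  shows "strict_gradient (\<lambda>x. \<Sum>k\<in>K. f k x) a (\<Sum>k\<in>K. v k)"
  using assms
  by (induction K rule: infinite_finite_induct) (simp_all add: strict_gradient_const strict_gradient_add)

lemma strict_gradient_power:
  "strict_gradient (\<lambda>x. x $ j ^ k) a (\<chi> i. if i = j then of_nat k * a $ j ^ (k - 1) else 0)"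
proof (induction k)
  case 0
  show ?case
    using strict_gradient_const[of 1 a] by (simp add: zero_vec_def if_distrib cong: if_cong)
next
  case (Suc k)
  have "a $ j * (of_nat k * a $ j ^ (k - 1)) + a $ j ^ k = of_nat (Suc k) * a $ j ^ (Suc k - 1)"
    by (cases k) (simp_all add: algebra_simps)
  then have "a $ j *s (\<chi> i. if i = j then of_nat k * a $ j ^ (k - 1) else 0)
        + a $ j ^ k *s (\<chi> i. if i = j then 1 else 0)
      = (\<chi> i. if i = j then of_nat (Suc k) * a $ j ^ (Suc k - 1) else 0)"
    by (simp add: vec_eq_iff)
  with strict_gradient_mult[OF strict_gradient_coordinate[of j a] Suc] show ?case
    by simp
qed

lemma strict_gradient_prod:
  assumes "finite K" "\<And>k. k \<in> K \<Longrightarrow> strict_gradient (f k) a (v k)"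
  shows "strict_gradient (\<lambda>x. \<Prod>k\<in>K. f k x) a (\<Sum>k\<in>K. (\<Prod>j\<in>K - {k}. f j a) *s v k)"
  using assms
proof (induction K rule: finite_induct)
  case empty
  show ?case
    using strict_gradient_const[of 1 a] by simp
next
  case (insert l K)
  have "(\<Prod>j\<in>insert l K - {k}. f j a) *s v k = f l a *s ((\<Prod>j\<in>K - {k}. f j a) *s v k)" if "k \<in> K" for k
  proof -
    have "insert l K - {k} = insert l (K - {k})"
      using insert.hyps that by auto
    then show ?thesis
      using insert.hyps by simp
  qed
  then have "(\<Sum>k\<in>insert l K. (\<Prod>j\<in>insert l K - {k}. f j a) *s v k)
      = f l a *s (\<Sum>k\<in>K. (\<Prod>j\<in>K - {k}. f j a) *s v k) + (\<Prod>j\<in>K. f j a) *s v l"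
    using insert.hyps by (simp add: vec_eq_iff sum_distrib_left mult.assoc)
  moreover have "strict_gradient (\<lambda>x. \<Prod>k\<in>K. f k x) a (\<Sum>k\<in>K. (\<Prod>j\<in>K - {k}. f j a) *s v k)"
    using insert by simp
  ultimately show ?case
    using strict_gradient_mult[of "f l" a "v l"] insert by (simp add: add.commute)
qed

definition mpoly_gradient :: "('n::finite, 'a::comm_ring_1) mpoly \<Rightarrow> 'a ^ 'n \<Rightarrow> 'a ^ 'n" where
  "mpoly_gradient f a = (\<chi> i. mpoly_eval (mpoly_pderiv i f) a)"

lemma strict_gradient_mpoly:
  fixes f :: "('n::finite, 'a::{comm_ring_1, topological_ab_group_add, topological_semigroup_mult}) mpoly"
  shows "strict_gradient (mpoly_eval f) a (mpoly_gradient f a)"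
proof -
  let ?e = "\<lambda>k i. Poly_Mapping.lookup k i"
  define v where "v k i = (\<chi> l. if l = i then of_nat (?e k i) * a $ i ^ (?e k i - 1) else 0)" for k i
  have "strict_gradient (\<lambda>x. \<Sum>k\<in>Poly_Mapping.keys f. ?e f k * (\<Prod>i\<in>UNIV. x $ i ^ ?e k i)) a
      (\<Sum>k\<in>Poly_Mapping.keys f. ?e f k *s (\<Sum>i\<in>UNIV. (\<Prod>j\<in>UNIV - {i}. a $ j ^ ?e k j) *s v k i))"
    unfolding v_def by (intro strict_gradient_sum strict_gradient_scale strict_gradient_prod strict_gradient_power finite)
  moreover have "mpoly_gradient f a
      = (\<Sum>k\<in>Poly_Mapping.keys f. ?e f k *s (\<Sum>i\<in>UNIV. (\<Prod>j\<in>UNIV - {i}. a $ j ^ ?e k j) *s v k i))"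
    unfolding mpoly_gradient_def v_def
    by (simp add: vec_eq_iff mpoly_eval_pderiv if_distrib ac_simps cong: if_cong)
  ultimately show ?thesis
    by (simp add: mpoly_eval_def[abs_def])
qed

lemma tendsto_mpoly_eval:
  fixes f :: "('n::finite, 'a::{comm_ring_1, topological_ab_group_add, topological_semigroup_mult}) mpoly"
  shows "(mpoly_eval f \<longlongrightarrow> mpoly_eval f a) (nhds a)"
  by (rule strict_gradient_continuous[OF strict_gradient_mpoly])

section \<open>Local equations of an algebraic set\<close>

text \<open>Every membership in a local ideal comes with a denominator, and the resulting vanishing holds
  where this denominator does not vanish. So each of the finitely many equations vanishes on \<open>V\<close>
  near \<open>a\<close>; conversely the Hilbert basis theorem leaves only finitely many conditions defining \<open>V\<close>
  to be deduced from the equations.\<close>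

lemma locally_zeros_of_equations:
  fixes V :: "('a::{nonarch_idom} fract ^ 'n::finite) set"
  assumes V: "algebraic_set V" and a: "a \<in> V"
    and eq: "local_ideal a (ideal_generated (set fs)) = local_ideal a (vanishing_ideal V)"
  shows "\<forall>\<^sub>F x in nhds a. x \<in> V \<longleftrightarrow> (\<forall>f\<in>set fs. mpoly_eval f x = 0)"
proof -
  have nonzero: "\<forall>\<^sub>F x in nhds a. mpoly_eval h x \<noteq> 0" if "mpoly_eval h a \<noteq> 0" for h :: "('n, 'a fract) mpoly"
    using tendsto_imp_eventually_ne[OF tendsto_mpoly_eval that] .
  have sub: "I \<subseteq> local_ideal a I" for I :: "('n, 'a fract) mpoly set"
    unfolding local_ideal_def by (auto intro!: exI[of _ 1])
  have forward: "\<forall>\<^sub>F x in nhds a. x \<in> V \<longrightarrow> mpoly_eval f x = 0" if "f \<in> set fs" for f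
  proof -
    have "f \<in> ideal_generated (set fs)"
      unfolding ideal_generated_def using that by (intro module.span_base[OF module_mult])
    then obtain h where h: "mpoly_eval h a \<noteq> 0" "h * f \<in> vanishing_ideal V"
      using sub[of "ideal_generated (set fs)"] eq unfolding local_ideal_def by blast
    show ?thesis
      using nonzero[OF h(1)]
    proof eventually_elim
      case (elim x)
      then show ?case
        using h(2) by (auto simp: vanishing_ideal_def mpoly_eval_mult)
    qed
  qed
  obtain T where T: "finite T" "V = zero_locus T"
    using V zero_locus_finite unfolding algebraic_set_def by metis
  have backward: "\<forall>\<^sub>F x in nhds a. (\<forall>f\<in>set fs. mpoly_eval f x = 0) \<longrightarrow> mpoly_eval t x = 0" if "t \<in> T" for t
  proof -
    have "t \<in> vanishing_ideal V"
      using that T(2) by (auto simp: vanishing_ideal_def zero_locus_def)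
    then obtain h where h: "mpoly_eval h a \<noteq> 0" "h * t \<in> ideal_generated (set fs)"
      using sub[of "vanishing_ideal V"] eq unfolding local_ideal_def by blast
    show ?thesis
      using nonzero[OF h(1)]
    proof eventually_elim
      case (elim x)
      then show ?case
        using mpoly_eval_ideal_generated[OF h(2), of x] by (auto simp: mpoly_eval_mult)
    qed
  qed
  have "\<forall>\<^sub>F x in nhds a. \<forall>f\<in>set fs. x \<in> V \<longrightarrow> mpoly_eval f x = 0"
    using forward by (intro eventually_ball_finite) auto
  moreover have "\<forall>\<^sub>F x in nhds a. \<forall>t\<in>T. (\<forall>f\<in>set fs. mpoly_eval f x = 0) \<longrightarrow> mpoly_eval t x = 0"
    using backward T(1) by (intro eventually_ball_finite) auto
  ultimately show ?thesis
  proof eventually_elim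
    case (elim x)
    have "x \<in> V \<longleftrightarrow> (\<forall>t\<in>T. mpoly_eval t x = 0)"
      by (simp add: T(2) zero_locus_def)
    then show ?case
      using elim by blast
  qed
qed

section \<open>Reduction to equations solved for some of the coordinates\<close>

lemma fract_abs_1 [simp]: "fract_abs 1 = 1"
  using fract_abs_Fract[of 1 1] by (simp add: One_fract_def)

lemma fract_abs_0 [simp]: "fract_abs 0 = 0"
  by (simp only: fract_abs_eq_0_iff)

lemma fract_abs_diff_le:
  assumes "fract_abs x \<le> r" "fract_abs y \<le> r"
  shows "fract_abs (x - y) \<le> r"
  using fract_abs_add[of x "- y"] assms by simp

lemma fract_abs_sum_le:
  assumes "\<And>i. i \<in> A \<Longrightarrow> fract_abs (f i) \<le> r" "0 \<le> r"
  shows "fract_abs (sum f A) \<le> r"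
  using assms(1)
proof (induction A rule: infinite_finite_induct)
  case (insert i A)
  then have "max (fract_abs (f i)) (fract_abs (sum f A)) \<le> r"
    by simp
  with fract_abs_add have "fract_abs (f i + sum f A) \<le> r"
    by (rule order_trans)
  then show ?case
    using insert.hyps by simp
qed (use assms(2) in simp_all)

text \<open>Gaussian elimination, one equation at a time: the new equation is freed of the variables
  already solved for, divided by the entry of its gradient of largest absolute value, and then used
  to eliminate the new variable from the other equations. The gradients stay in the span of the
  original ones, so by independence the new gradient does not become zero.\<close>

lemma solved_equations:
  fixes F :: "'b \<Rightarrow> 'a::nonarch_idom fract ^ 'n::finite \<Rightarrow> 'a fract"
  assumes "\<And>f. f \<in> set fs \<Longrightarrow> strict_gradient (F f) a (D f)"
    and "vec.dim (D ` set fs) = length fs"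
  shows "\<exists>(J :: 'n set) g w. card J = length fs \<and>
    (\<forall>x. (\<forall>j\<in>J. g j x = 0) \<longleftrightarrow> (\<forall>f\<in>set fs. F f x = 0)) \<and>
    (\<forall>j\<in>J. strict_gradient (g j) a (w j) \<and> w j \<in> vec.span (D ` set fs) \<and>
      (\<forall>i\<in>J. w j $ i = (if i = j then 1 else 0)) \<and> (\<forall>i. fract_abs (w j $ i) \<le> 1))"
    (is "\<exists>J g w. ?P fs J g w")
  using assms
proof (induction fs)
  case Nil
  show ?case
    by (intro exI[of _ "{}"]) simp
next
  case (Cons f fs)
  let ?U = "vec.span (D ` set fs)"
  have "vec.dim (D ` set fs) \<le> length fs"
    using vec.dim_le_card'[of "D ` set fs"] card_image_le[of "set fs" D] card_length[of fs] by simp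
  moreover have "vec.dim (insert (D f) (D ` set fs)) = Suc (length fs)"
    using Cons.prems(2) by simp
  ultimately have dim: "vec.dim (D ` set fs) = length fs" and fU: "D f \<notin> ?U"
    by (auto simp: vec.dim_insert split: if_splits)
  have "\<exists>J g w. ?P fs J g w"
    by (rule Cons.IH) (use Cons.prems(1) dim in auto)
  then obtain J :: "'n set" and g w where "?P fs J g w"
    by blast
  then have J: "card J = length fs"
    and zeros: "\<And>x. (\<forall>j\<in>J. g j x = 0) \<longleftrightarrow> (\<forall>f\<in>set fs. F f x = 0)"
    and g: "\<And>j. j \<in> J \<Longrightarrow> strict_gradient (g j) a (w j)"
    and w: "\<And>j. j \<in> J \<Longrightarrow> w j \<in> ?U"
      "\<And>j i. j \<in> J \<Longrightarrow> i \<in> J \<Longrightarrow> w j $ i = (if i = j then 1 else 0)"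
      "\<And>j i. j \<in> J \<Longrightarrow> fract_abs (w j $ i) \<le> 1"
    by blast+
  \<comment> \<open>Eliminate the variables in \<open>J\<close> from the new equation.\<close>
  define h where "h x = F f x - (\<Sum>j\<in>J. D f $ j * g j x)" for x
  define u where "u = D f - (\<Sum>j\<in>J. D f $ j *s w j)"
  have "strict_gradient (\<lambda>x. \<Sum>j\<in>J. D f $ j * g j x) a (\<Sum>j\<in>J. D f $ j *s w j)"
    by (intro strict_gradient_sum strict_gradient_scale g)
  from strict_gradient_add[OF Cons.prems(1)[of f] strict_gradient_scale[OF this, of "- 1"]]
  have h: "strict_gradient h a u"
    by (simp add: h_def[abs_def] u_def vec.scale_minus_left)
  have sumU: "(\<Sum>j\<in>J. D f $ j *s w j) \<in> ?U"
    by (intro vec.span_sum vec.span_scale w)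
  have "u \<noteq> 0"
    using fU sumU by (auto simp: u_def)
  have uJ: "u $ i = 0" if "i \<in> J" for i
  proof -
    have "(\<Sum>j\<in>J. D f $ j * w j $ i) = (\<Sum>j\<in>J. if j = i then D f $ i else 0)"
      using w(2)[OF _ that] by (intro sum.cong) auto
    then show ?thesis
      using that by (simp add: u_def)
  qed
  \<comment> \<open>The largest entry as pivot keeps all entries integral.\<close>
  obtain l where l: "\<And>i. fract_abs (u $ i) \<le> fract_abs (u $ l)"
  proof -
    have "Max (range (\<lambda>i. fract_abs (u $ i))) \<in> range (\<lambda>i. fract_abs (u $ i))"
      by (rule Max_in) auto
    then obtain l where "Max (range (\<lambda>i. fract_abs (u $ i))) = fract_abs (u $ l)"
      by blast
    then have "fract_abs (u $ i) \<le> fract_abs (u $ l)" for i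
      using Max_ge[of "range (\<lambda>i. fract_abs (u $ i))" "fract_abs (u $ i)"] by simp
    then show thesis
      by (rule that)
  qed
  have ul: "u $ l \<noteq> 0"
  proof
    assume "u $ l = 0"
    then have "fract_abs (u $ i) = 0" for i
      using l[of i] fract_abs_nonneg[of "u $ i"] by simp
    then show False
      using \<open>u \<noteq> 0\<close> by (simp add: vec_eq_iff)
  qed
  then have lJ: "l \<notin> J"
    using uJ by blast
  define c where "c = inverse (u $ l)"
  define g' where "g' j = (if j = l then (\<lambda>x. c * h x) else (\<lambda>x. g j x - w j $ l * (c * h x)))" for j
  define w' where "w' j = (if j = l then c *s u else w j - w j $ l *s (c *s u))" for j
  have c: "c \<noteq> 0" "c * u $ l = 1"
    using ul by (auto simp: c_def)
  have cu: "fract_abs (c * u $ i) \<le> 1" for i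
  proof -
    have "fract_abs c * fract_abs (u $ i) \<le> fract_abs c * fract_abs (u $ l)"
      by (intro mult_left_mono l fract_abs_nonneg)
    then show ?thesis
      using c(2) by (simp flip: fract_abs_mult)
  qed
  have card: "card (insert l J) = length (f # fs)"
    using J lJ by simp
  have zeros': "\<forall>x. (\<forall>j\<in>insert l J. g' j x = 0) \<longleftrightarrow> (\<forall>f\<in>set (f # fs). F f x = 0)"
  proof
    fix x
    have "(\<forall>j\<in>insert l J. g' j x = 0) \<longleftrightarrow> h x = 0 \<and> (\<forall>j\<in>J. g j x = 0)"
      using lJ c(1) by (auto simp: g'_def)
    also have "\<dots> \<longleftrightarrow> F f x = 0 \<and> (\<forall>j\<in>J. g j x = 0)"
      by (auto simp: h_def)
    finally show "(\<forall>j\<in>insert l J. g' j x = 0) \<longleftrightarrow> (\<forall>f\<in>set (f # fs). F f x = 0)"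
      by (simp add: zeros)
  qed
  have gradients': "\<forall>j\<in>insert l J. strict_gradient (g' j) a (w' j) \<and> w' j \<in> vec.span (D ` set (f # fs)) \<and>
      (\<forall>i\<in>insert l J. w' j $ i = (if i = j then 1 else 0)) \<and> (\<forall>i. fract_abs (w' j $ i) \<le> 1)"
  proof (rule ballI, intro conjI ballI allI)
    fix j assume j: "j \<in> insert l J"
    have ch: "strict_gradient (\<lambda>x. c * h x) a (c *s u)"
      by (rule strict_gradient_scale[OF h])
    have "strict_gradient (\<lambda>x. g j x - w j $ l * (c * h x)) a (w j - w j $ l *s (c *s u))" if "j \<in> J"
      using strict_gradient_add[OF g[OF that] strict_gradient_scale[OF ch, of "- (w j $ l)"]]
      by (simp add: vec.scale_minus_left)
    then show "strict_gradient (g' j) a (w' j)"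
      using ch j by (auto simp: g'_def w'_def)
    have sub: "?U \<subseteq> vec.span (D ` set (f # fs))"
      by (rule vec.span_mono) auto
    have "D f \<in> vec.span (D ` set (f # fs))"
      by (rule vec.span_base) simp
    then have "c *s u \<in> vec.span (D ` set (f # fs))"
      unfolding u_def using sumU sub by (intro vec.span_scale vec.span_diff) auto
    then show "w' j \<in> vec.span (D ` set (f # fs))"
      using j sub w(1)[of j] vec.span_scale[of "c *s u" _ "w j $ l"]
      by (auto simp: w'_def simp del: vec.scale_scale intro!: vec.span_diff)
  next
    fix j i assume j: "j \<in> insert l J" and i: "i \<in> insert l J"
    show "w' j $ i = (if i = j then 1 else 0)"
      using i j lJ uJ[of i] w(2)[of j i] c by (auto simp: w'_def)
  next
    fix j i assume j: "j \<in> insert l J"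
    have "fract_abs (w j $ i - w j $ l * (c * u $ i)) \<le> 1" if "j \<in> J"
      using w(3)[OF that] cu[of i] fract_abs_nonneg[of "c * u $ i"]
      by (intro fract_abs_diff_le) (simp_all add: fract_abs_mult[of "w j $ l"] mult_le_one)
    then show "fract_abs (w' j $ i) \<le> 1"
      using j cu[of i] by (auto simp: w'_def mult.assoc)
  qed
  show ?case
    by (intro exI[of _ "insert l J"] exI[of _ g'] exI[of _ w'] conjI card zeros' gradients')
qed

section \<open>Divisibility and limits of $p$-adic integers\<close>

lemma residue_bounds:
  fixes x :: "'p::prime_card padic_int"
  shows "0 \<le> residue x m" "residue x m < int CARD('p) ^ m"
  using residue_mod_same[of x m] pos_mod_sign[of "int CARD('p) ^ m" "residue x m"]
    pos_mod_bound[of "int CARD('p) ^ m" "residue x m"] by simp_all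

lemma residue_diff_eq_0_iff:
  fixes x y :: "'p::prime_card padic_int"
  shows "residue (x - y) m = 0 \<longleftrightarrow> residue x m = residue y m"
proof -
  have "residue (x - y) m = 0 \<longleftrightarrow> residue x m mod int CARD('p) ^ m = residue y m mod int CARD('p) ^ m"
    by (simp only: residue_simps mod_eq_dvd_iff dvd_eq_mod_eq_0)
  then show ?thesis
    by simp
qed

lemma residue_antimono:
  fixes x y :: "'p::prime_card padic_int"
  assumes "residue x m = residue y m" "k \<le> m"
  shows "residue x k = residue y k"
  using residue_mod[OF assms(2), of x] residue_mod[OF assms(2), of y] assms(1) by simp

lemma residue_eq_0_antimono:
  "residue (x :: 'p::prime_card padic_int) m = 0 \<Longrightarrow> k \<le> m \<Longrightarrow> residue x k = 0"
  using residue_antimono[of x m 0 k] by (simp add: residue_simps)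

lemma residue_eq_0_ideal:
  fixes x y :: "'p::prime_card padic_int"
  shows "residue x m = 0 \<Longrightarrow> residue y m = 0 \<Longrightarrow> residue (x + y) m = 0"
    and "residue x m = 0 \<Longrightarrow> residue y m = 0 \<Longrightarrow> residue (x - y) m = 0"
    and "residue y m = 0 \<Longrightarrow> residue (x * y) m = 0"
  by (simp_all add: residue_simps)

lemma residue_eq_0_sum:
  "(\<And>i. i \<in> A \<Longrightarrow> residue (f i :: 'p::prime_card padic_int) m = 0) \<Longrightarrow> residue (sum f A) m = 0"
  by (induction A rule: infinite_finite_induct) (simp_all add: residue_simps)

lemma residue_of_nat: "residue (of_nat n :: 'p::prime_card padic_int) m = int n mod int CARD('p) ^ m"
  by (induction n) (simp_all add: residue_simps mod_simps)

lemma residue_of_int: "residue (of_int z :: 'p::prime_card padic_int) m = z mod int CARD('p) ^ m"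
  by (cases z rule: int_cases2) (simp_all add: residue_simps residue_of_nat mod_simps)

text \<open>The successive digits of \<open>x s\<close> stabilize, and the stable ones form the limit.\<close>

lemma padic_int_limit:
  fixes x :: "nat \<Rightarrow> 'p::prime_card padic_int"
  assumes "\<And>s. residue (x (Suc s)) s = residue (x s) s"
  shows "\<exists>y :: 'p padic_int. \<forall>s. residue y s = residue (x s) s"
proof -
  have "residue (Abs_padic_int (\<lambda>s. residue (x s) s) :: 'p padic_int) = (\<lambda>s. residue (x s) s)"
    by (rule Abs_padic_int_inverse) (simp add: residue_mod assms)
  then show ?thesis
    by (intro exI[of _ "Abs_padic_int (\<lambda>s. residue (x s) s) :: 'p padic_int"]) simp
qed

text \<open>The quotient is found digit by digit, as the unit part of \<open>b\<close> is invertible modulo \<open>p\<close>.\<close>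

lemma padic_int_dvd:
  fixes a b :: "'p::prime_card padic_int"
  assumes b: "b \<noteq> 0" and a: "residue a (padic_val b) = 0"
  shows "b dvd a"
proof -
  let ?p = "int CARD('p)" and ?v = "padic_val b"
  have p: "prime ?p"
    using prime_CARD[where 'a='p] by simp
  \<comment> \<open>A quotient modulo \<open>p ^ s\<close> is refined by one more digit.\<close>
  have step: "\<exists>c'. residue (a - c' * b) (?v + Suc s) = 0 \<and> residue c' s = residue c s"
    if c: "residue (a - c * b) (?v + s) = 0" for c s
  proof -
    let ?m = "?v + Suc s"
    have "?p ^ ?v dvd residue b ?m" "\<not> ?p ^ Suc ?v dvd residue b ?m"
      using residue_eq_0_iff_dvd[of ?v ?m b] residue_eq_0_iff_dvd[of "Suc ?v" ?m b]
        residue_eq_0_iff[OF b] by (auto simp del: power_Suc)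
    then obtain u where u: "residue b ?m = ?p ^ ?v * u" "\<not> ?p dvd u"
      by (auto elim!: dvdE[of "?p ^ ?v"])
    obtain r where r: "residue (a - c * b) ?m = ?p ^ (?v + s) * r"
      using c residue_eq_0_iff_dvd[of "?v + s" ?m "a - c * b"] by auto
    have "gcd u ?p = 1"
      using prime_imp_coprime[OF p u(2)] by (simp add: coprime_iff_gcd_eq_1 gcd.commute)
    then obtain e k where "e * u + k * ?p = 1"
      using bezout_int[of u ?p] by auto
    then have "u * e - 1 = ?p * (- k)"
      by (simp add: algebra_simps)
    then have "?p dvd u * e - 1"
      by simp
    then have "?p dvd r * (u * e - 1)"
      by (rule dvd_mult)
    then have "?p ^ (?v + s) * ?p dvd ?p ^ (?v + s) * (r * (u * e - 1))"
      by (rule mult_dvd_mono[OF dvd_refl])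
    then have dvd: "?p ^ ?m dvd ?p ^ (?v + s) * r - ?p ^ s * (r * e) * (?p ^ ?v * u)"
      by (subst dvd_diff_commute) (simp add: power_add algebra_simps)
    define c' where "c' = c + of_int (?p ^ s * (r * e))"
    have "a - c' * b = (a - c * b) - of_int (?p ^ s * (r * e)) * b"
      by (simp add: c'_def algebra_simps)
    then have "residue (a - c' * b) ?m
        = (residue (a - c * b) ?m - residue (of_int (?p ^ s * (r * e)) * b) ?m) mod ?p ^ ?m"
      by (simp only: residue_simps(6)[of "a - c * b"])
    also have "\<dots> = (residue (a - c * b) ?m - residue (of_int (?p ^ s * (r * e)) :: 'p padic_int) ?m * residue b ?m) mod ?p ^ ?m"
      by (subst residue_simps(4)) (rule mod_diff_right_eq)
    also have "\<dots> = (?p ^ (?v + s) * r - ?p ^ s * (r * e) * (?p ^ ?v * u)) mod ?p ^ ?m"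
      by (simp only: residue_of_int u r) (subst (1 2) mod_diff_right_eq[symmetric], simp only: mod_mult_left_eq)
    finally have "residue (a - c' * b) ?m = 0"
      using dvd by simp
    moreover have "residue (c' - c) s = 0"
      by (simp add: c'_def residue_of_int del: of_int_mult of_int_power)
    then have "residue c' s = residue c s"
      by (simp only: residue_diff_eq_0_iff)
    ultimately show ?thesis
      by blast
  qed
  have "\<exists>c. \<forall>s. residue (a - c s * b) (?v + s) = 0 \<and> residue (c (Suc s)) s = residue (c s) s"
    by (rule dependent_nat_choice[where P = "\<lambda>s c. residue (a - c * b) (?v + s) = 0"
          and Q = "\<lambda>s c c'. residue c' s = residue c s"])
      (use a step in \<open>auto intro!: exI[of _ 0] simp: residue_simps(1)\<close>)
  then obtain c where c: "\<And>s. residue (a - c s * b) (?v + s) = 0" "\<And>s. residue (c (Suc s)) s = residue (c s) s"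
    by blast
  obtain q :: "'p padic_int" where q: "\<And>s. residue q s = residue (c s) s"
    using padic_int_limit[of c, OF c(2)] by blast
  have "residue (a - q * b) s = 0" for s
  proof -
    have "residue (q - c s) s = 0"
      by (simp add: residue_diff_eq_0_iff q)
    then have "residue (b * (q - c s)) s = 0"
      by (rule residue_eq_0_ideal(3))
    moreover have "residue (a - c s * b) s = 0"
      using c(1)[of s] by (rule residue_eq_0_antimono) simp
    ultimately have "residue ((a - c s * b) - b * (q - c s)) s = 0"
      by (rule residue_eq_0_ideal(2)[rotated])
    also have "(a - c s * b) - b * (q - c s) = a - q * b"
      by (simp add: algebra_simps)
    finally show ?thesis .
  qed
  then have "a - q * b = 0"
    by (intro padic_int_eqI) (simp add: residue_simps(1))
  then show ?thesis
    by simp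
qed

lemma nonarch_abs_le_iff:
  fixes x :: "'p::prime_card padic_int"
  shows "nonarch_abs x \<le> (1 / real CARD('p)) ^ k \<longleftrightarrow> residue x k = 0"
proof (cases "x = 0")
  case False
  have "1 < CARD('p)"
    by (rule prime_gt_1_nat[OF prime_CARD])
  then show ?thesis
    using False by (simp add: nonarch_abs_padic_int_def residue_eq_0_iff power_decreasing_iff del: power_one_over)
qed (simp add: nonarch_abs_padic_int_def residue_simps)

lemma fract_abs_to_fract [simp]: "fract_abs (to_fract x) = nonarch_abs x"
  by (simp add: to_fract_def fract_abs_Fract)

lemma integral_iff:
  fixes q :: "'p::prime_card padic"
  shows "fract_abs q \<le> 1 \<longleftrightarrow> q \<in> range to_fract"
proof
  assume q: "fract_abs q \<le> 1"
  obtain a b where ab: "q = Fract a b" "b \<noteq> 0"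
    by (cases q)
  have "0 < nonarch_abs b"
    using ab(2) nonarch_abs_nonneg[of b] by (simp add: less_le)
  then have "nonarch_abs a \<le> nonarch_abs b"
    using q ab by (simp add: fract_abs_Fract divide_le_eq)
  then have "nonarch_abs a \<le> (1 / real CARD('p)) ^ padic_val b"
    using ab(2) by (simp add: nonarch_abs_padic_int_def[of b])
  then have "b dvd a"
    unfolding nonarch_abs_le_iff by (rule padic_int_dvd[OF ab(2)])
  then obtain c where "a = b * c" ..
  then have "q = to_fract c"
    using ab by (simp add: to_fract_def eq_fract)
  then show "q \<in> range to_fract"
    by blast
next
  assume "q \<in> range to_fract"
  then show "fract_abs q \<le> 1"
    using nonarch_abs_le_iff[of _ 0] by auto
qed

lemma reduction_eq_iff: "reduction m x = reduction m y \<longleftrightarrow> (\<forall>i. residue (x $ i) m = residue (y $ i) m)"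
  by (simp add: reduction_def vec_eq_iff)

lemma reduction_antimono:
  fixes x y :: "'p::prime_card padic_int ^ 'n::finite"
  assumes "reduction m x = reduction m y" "k \<le> m"
  shows "reduction k x = reduction k y"
  unfolding reduction_eq_iff
  by (intro allI residue_antimono[OF _ assms(2)]) (use assms(1) in \<open>simp add: reduction_eq_iff\<close>)

section \<open>Points in a residue class\<close>

lemma card_residue_lifts:
  fixes c :: int and p :: nat
  assumes "0 \<le> c" "c < int p ^ m" "0 < p"
  shows "card {t \<in> {0..<int p ^ Suc m}. t mod int p ^ m = c} = p"
proof -
  have "{t \<in> {0..<int p ^ Suc m}. t mod int p ^ m = c} = (\<lambda>s. c + int p ^ m * s) ` {0..<int p}" (is "?L = ?R")
  proof (intro set_eqI iffI)
    fix t assume t: "t \<in> ?L"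
    then have "0 \<le> t div int p ^ m"
      using assms(3) by (simp add: pos_imp_zdiv_nonneg_iff)
    moreover have "t div int p ^ m < int p"
    proof -
      have "t div int p ^ m * int p ^ m \<le> t"
        using assms(3) by (simp flip: minus_mod_eq_div_mult)
      also have "t < int p * int p ^ m"
        using t by simp
      finally show ?thesis
        using assms(3) by simp
    qed
    moreover have "t = c + int p ^ m * (t div int p ^ m)"
      using t by (auto simp: mult.commute)
    ultimately show "t \<in> ?R"
      by auto
  next
    fix t assume "t \<in> ?R"
    then obtain s where s: "t = c + int p ^ m * s" "0 \<le> s" "s + 1 \<le> int p"
      by auto
    have "int p ^ m * (s + 1) \<le> int p ^ m * int p"
      using s(3) by (intro mult_left_mono) auto
    then show "t \<in> ?L"
      using s assms by (auto simp: algebra_simps)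
  qed
  moreover have "inj_on (\<lambda>s. c + int p ^ m * s) {0..<int p}"
    using assms(3) by (auto simp: inj_on_def)
  ultimately show ?thesis
    by (simp add: card_image)
qed

text \<open>The first hypothesis is strict differentiability of the \<open>G j\<close> on a ball around \<open>z\<close>, with a
  gradient that is the unit vector \<open>j\<close> on the coordinates in \<open>J\<close> and \<open>C j\<close> on the others, and with
  an error smaller by a factor \<open>p\<close> than the distance of the points. The points of the fibre correspond
  to the lifts of the coordinates outside \<open>J\<close> from \<open>p ^ m\<close> to \<open>p ^ Suc m\<close>: they determine the
  coordinates in \<open>J\<close> because the error is invisible modulo \<open>p ^ Suc m\<close>, and all of them occur because
  the equations can be solved by successive approximation.\<close>

lemma card_fibre_of_solved_equations:
  fixes G :: "'n::finite \<Rightarrow> 'p::prime_card padic_int ^ 'n \<Rightarrow> 'p padic_int"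
    and C :: "'n \<Rightarrow> 'n \<Rightarrow> 'p padic_int"
  assumes lin: "\<And>x y s j. reduction k x = reduction k z \<Longrightarrow> reduction k y = reduction k z \<Longrightarrow>
      reduction s x = reduction s y \<Longrightarrow> j \<in> J \<Longrightarrow>
      residue (G j x - G j y - (x $ j - y $ j + (\<Sum>i\<in>-J. C j i * (x $ i - y $ i)))) (Suc s) = 0"
    and z: "\<And>j. j \<in> J \<Longrightarrow> G j z = 0"
    and m: "k \<le> m"
  shows "card (reduction (Suc m) ` {x. reduction m x = reduction m z \<and> (\<forall>j\<in>J. G j x = 0)})
    = CARD('p) ^ card (- J)"
proof -
  let ?p = "int CARD('p)"
  let ?D = "{x. reduction m x = reduction m z \<and> (\<forall>j\<in>J. G j x = 0)}"
  let ?T = "\<lambda>i. {t \<in> {0..<?p ^ Suc m}. t mod ?p ^ m = residue (z $ i) m}"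
  let ?\<psi> = "\<lambda>c :: int ^ 'n. restrict (\<lambda>i. c $ i) (- J)"
  have p: "0 < CARD('p)"
    by simp
  have near: "reduction k x = reduction k z" if "reduction m x = reduction m z" for x :: "'p padic_int ^ 'n"
    using reduction_antimono[OF that m] .
  have lipschitz: "residue (G j x - G j y) s = 0"
    if "reduction m x = reduction m z" "reduction m y = reduction m z" "reduction s x = reduction s y" "j \<in> J"
    for x y s j
  proof -
    let ?L = "x $ j - y $ j + (\<Sum>i\<in>-J. C j i * (x $ i - y $ i))"
    have "residue (G j x - G j y - ?L) s = 0"
      using lin[OF near near, OF that] by (rule residue_eq_0_antimono) simp
    moreover have "residue (x $ i - y $ i) s = 0" for i
      using that(3) by (simp add: reduction_eq_iff residue_diff_eq_0_iff)
    then have "residue ?L s = 0"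
      by (intro residue_eq_0_ideal(1,3) residue_eq_0_sum)
    ultimately have "residue (G j x - G j y - ?L + ?L) s = 0"
      by (rule residue_eq_0_ideal(1))
    then show ?thesis
      by simp
  qed
  have "bij_betw ?\<psi> (reduction (Suc m) ` ?D) (PiE (- J) ?T)"
    unfolding bij_betw_def
  proof (intro conjI inj_onI)
    fix c d
    assume "c \<in> reduction (Suc m) ` ?D" "d \<in> reduction (Suc m) ` ?D" and cd: "?\<psi> c = ?\<psi> d"
    then obtain x y where xy: "c = reduction (Suc m) x" "d = reduction (Suc m) y" "x \<in> ?D" "y \<in> ?D"
      by blast
    have off: "residue (x $ i - y $ i) (Suc m) = 0" if "i \<in> - J" for i
      using fun_cong[OF cd, of i] that by (simp add: xy(1,2) reduction_def residue_diff_eq_0_iff)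
    have "residue (x $ j - y $ j) (Suc m) = 0" if j: "j \<in> J" for j
    proof -
      let ?S = "\<Sum>i\<in>-J. C j i * (x $ i - y $ i)"
      have "residue (G j x - G j y - (x $ j - y $ j + ?S)) (Suc m) = 0"
        using xy j by (intro lin near) auto
      then have "residue (- (x $ j - y $ j + ?S)) (Suc m) = 0"
        using xy(3,4) j by simp
      moreover have "residue ?S (Suc m) = 0"
        by (intro residue_eq_0_sum residue_eq_0_ideal(3) off)
      ultimately have "residue (0 - (- (x $ j - y $ j + ?S) + ?S)) (Suc m) = 0"
        by (intro residue_eq_0_ideal) (simp_all add: residue_simps(1))
      then show ?thesis
        by simp
    qed
    with off have "residue (x $ i) (Suc m) = residue (y $ i) (Suc m)" for i
      by (cases "i \<in> J") (auto simp: residue_diff_eq_0_iff)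
    then show "c = d"
      by (simp add: xy(1,2) reduction_eq_iff)
  next
    show "?\<psi> ` reduction (Suc m) ` ?D = PiE (- J) ?T"
    proof (intro set_eqI iffI)
      fix t assume "t \<in> ?\<psi> ` reduction (Suc m) ` ?D"
      then obtain x where x: "x \<in> ?D" "t = ?\<psi> (reduction (Suc m) x)"
        by blast
      have "residue (x $ i) (Suc m) mod ?p ^ m = residue (z $ i) m" for i
        using x(1) by (simp add: residue_mod reduction_eq_iff)
      then show "t \<in> PiE (- J) ?T"
        using residue_bounds[where 'p = 'p and m = "Suc m"] by (auto simp: x(2) reduction_def)
    next
      fix t assume t: "t \<in> PiE (- J) ?T"
      \<comment> \<open>Newton iteration in the coordinates in \<open>J\<close>, the others being prescribed by \<open>t\<close>: since the
        matrix of derivatives is the identity modulo \<open>p\<close>, the inverse of the derivative can be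
        replaced by the identity.\<close>
      define x where "x = rec_nat (\<chi> i. if i \<in> J then z $ i else of_int (t i))
        (\<lambda>_ y. \<chi> i. if i \<in> J then y $ i - G i y else y $ i)"
      have x_0: "x 0 = (\<chi> i. if i \<in> J then z $ i else of_int (t i))"
        and x_Suc: "x (Suc s) = (\<chi> i. if i \<in> J then x s $ i - G i (x s) else x s $ i)" for s
        unfolding x_def by simp_all
      have off: "x s $ i = of_int (t i)" if "i \<notin> J" for s i
        using that by (induction s) (simp_all add: x_0 x_Suc)
      have x: "reduction m (x s) = reduction m z \<and> (\<forall>j\<in>J. residue (G j (x s)) (m + s) = 0)" for s
      proof (induction s)
        case 0
        have "t i mod ?p ^ m = residue (z $ i) m" if "i \<notin> J" for i
          using t that by (auto simp: PiE_iff)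
        then have "reduction m (x 0) = reduction m z"
          by (simp add: x_0 reduction_eq_iff residue_of_int)
        then show ?case
          using lipschitz[of "x 0" z m] z by simp
      next
        case (Suc s)
        have close: "reduction (m + s) (x (Suc s)) = reduction (m + s) (x s)"
          using Suc.IH by (auto simp: reduction_eq_iff x_Suc residue_diff_eq_0_iff[symmetric] residue_simps(1,5))
        then have 1: "reduction m (x (Suc s)) = reduction m z"
          using reduction_antimono[OF close, of m] Suc.IH by simp
        have "residue (G j (x (Suc s))) (m + Suc s) = 0" if j: "j \<in> J" for j
        proof -
          have "residue (G j (x (Suc s)) - G j (x s) - (x (Suc s) $ j - x s $ j
              + (\<Sum>i\<in>-J. C j i * (x (Suc s) $ i - x s $ i)))) (Suc (m + s)) = 0"
            using 1 Suc.IH close j by (intro lin near) auto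
          moreover have "(\<Sum>i\<in>-J. C j i * (x (Suc s) $ i - x s $ i)) = 0"
            by (intro sum.neutral) (simp add: off)
          ultimately show ?thesis
            using j by (simp add: x_Suc)
        qed
        with 1 show ?case
          by blast
      qed
      have "residue (x (Suc s) $ i) s = residue (x s $ i) s" for s i
        using x[of s] residue_eq_0_antimono[of "G i (x s)" "m + s" s]
        by (simp add: x_Suc residue_diff_eq_0_iff[symmetric] residue_simps(1,5))
      then have "\<exists>y :: 'p padic_int. \<forall>s. residue y s = residue (x s $ i) s" for i
        by (rule padic_int_limit)
      then obtain y' :: "'n \<Rightarrow> 'p padic_int" where y': "\<And>i s. residue (y' i) s = residue (x s $ i) s"
        by metis
      define y where "y = (\<chi> i. y' i)"
      have y: "reduction s y = reduction s (x s)" for s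
        by (simp add: y_def reduction_eq_iff y')
      have ym: "reduction m y = reduction m z"
        using y[of m] x[of m] by simp
      have "G j y = 0" if j: "j \<in> J" for j
      proof (rule padic_int_eqI)
        fix s
        have "residue (G j y - G j (x s)) s = 0"
          using ym x y j by (intro lipschitz) auto
        moreover have "residue (G j (x s)) s = 0"
          using x[of s] j residue_eq_0_antimono[of "G j (x s)" "m + s" s] by simp
        ultimately have "residue (G j y - G j (x s) + G j (x s)) s = 0"
          by (rule residue_eq_0_ideal(1))
        then show "residue (G j y) s = residue 0 s"
          by (simp add: residue_simps(1))
      qed
      with ym have "y \<in> ?D"
        by blast
      moreover have "?\<psi> (reduction (Suc m) y) = t"
      proof
        fix i
        show "?\<psi> (reduction (Suc m) y) i = t i"
        proof (cases "i \<in> J")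
          case True
          then show ?thesis
            using t by (auto simp: PiE_iff extensional_def)
        next
          case False
          then have "t i \<in> ?T i"
            using t by (auto simp: PiE_iff)
          then show ?thesis
            using False by (simp add: reduction_def y_def y' off residue_of_int del: power_Suc)
        qed
      qed
      ultimately show "t \<in> ?\<psi> ` reduction (Suc m) ` ?D"
        by blast
    qed
  qed
  then have "card (reduction (Suc m) ` ?D) = card (PiE (- J) ?T)"
    by (rule bij_betw_same_card)
  also have "\<dots> = (\<Prod>i\<in>- J. card (?T i))"
    by (rule card_PiE) simp
  also have "\<dots> = CARD('p) ^ card (- J)"
    using residue_bounds[where 'p = 'p] p by (simp only: card_residue_lifts prod_constant)
  finally show ?thesis .
qed

section \<open>The residue classes near a point\<close>

lemma eventually_near_padic_embed:
  fixes a :: "'p::prime_card padic_int ^ 'n::finite"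
  assumes "\<forall>\<^sub>F x in nhds (padic_embed a). P x"
  shows "\<exists>k. \<forall>x. reduction k x = reduction k a \<longrightarrow> P (padic_embed x)"
proof -
  obtain e where e: "0 < e" "\<And>x. dist x (padic_embed a) < e \<Longrightarrow> P x"
    using assms by (auto simp: eventually_nhds_metric)
  have p: "1 < CARD('p)"
    by (rule prime_gt_1_nat[OF prime_CARD])
  then have "1 / real CARD('p) < 1"
    by simp
  then obtain k where k: "(1 / real CARD('p)) ^ k < e / real CARD('n)"
    using real_arch_pow_inv[of "e / real CARD('n)" "1 / real CARD('p)"] e(1) by auto
  have "P (padic_embed x)" if x: "reduction k x = reduction k a" for x
  proof (rule e(2))
    have "dist (padic_embed x) (padic_embed a) \<le> (\<Sum>i\<in>UNIV. dist (padic_embed x $ i) (padic_embed a $ i))"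
      unfolding dist_vec_def by (rule L2_set_le_sum) simp
    also have "\<dots> \<le> (\<Sum>i\<in>(UNIV :: 'n set). (1 / real CARD('p)) ^ k)"
    proof (rule sum_mono)
      fix i
      have "residue (x $ i - a $ i) k = 0"
        using x by (simp add: reduction_eq_iff residue_diff_eq_0_iff)
      then show "dist (padic_embed x $ i) (padic_embed a $ i) \<le> (1 / real CARD('p)) ^ k"
        by (simp add: dist_fract_def padic_embed_def nonarch_abs_le_iff del: power_one_over flip: to_fract_diff)
    qed
    also have "\<dots> < e"
      using k by (simp add: field_simps)
    finally show "dist (padic_embed x) (padic_embed a) < e" .
  qed
  then show ?thesis
    by blast
qed

lemma padic_embed_inject: "padic_embed x = padic_embed y \<longleftrightarrow> x = y"
  by (simp add: padic_embed_def vec_eq_iff)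

text \<open>The factor \<open>p\<close> is gained on the ball where the coefficients of the increment differ from the
  gradient by less than the absolute value of \<open>p\<close>; the ultrametric inequality does not let the
  errors of the coordinates add up.\<close>

lemma strict_gradient_near_padic_embed:
  fixes a :: "'p::prime_card padic_int ^ 'n::finite"
  assumes "strict_gradient g (padic_embed a) w"
  shows "\<exists>k. \<forall>x y s. reduction k x = reduction k a \<longrightarrow> reduction k y = reduction k a \<longrightarrow>
    reduction s x = reduction s y \<longrightarrow>
    fract_abs (g (padic_embed x) - g (padic_embed y) - (\<Sum>i\<in>UNIV. w $ i * to_fract (x $ i - y $ i)))
      \<le> (1 / real CARD('p)) ^ Suc s"
proof -
  let ?r = "1 / real CARD('p)"
  have r: "0 < ?r"
    by simp
  obtain q where q: "\<And>x y. g x - g y = (\<Sum>i\<in>UNIV. q i (x, y) * (x $ i - y $ i))"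
      "\<And>i. (q i \<longlongrightarrow> w $ i) (nhds (padic_embed a, padic_embed a))"
    using assms by (auto simp: strict_gradient_def)
  have "\<forall>\<^sub>F z in nhds (padic_embed a, padic_embed a). \<forall>i\<in>UNIV. dist (q i z) (w $ i) < ?r"
    using tendstoD[OF q(2) r] by (intro eventually_ball_finite) auto
  then obtain Q where Q: "eventually Q (nhds (padic_embed a))"
      "\<And>x y i. Q x \<Longrightarrow> Q y \<Longrightarrow> dist (q i (x, y)) (w $ i) < ?r"
    unfolding nhds_prod eventually_prod_same by blast
  obtain k where k: "\<And>x. reduction k x = reduction k a \<Longrightarrow> Q (padic_embed x)"
    using eventually_near_padic_embed[OF Q(1)] by blast
  have "fract_abs (g (padic_embed x) - g (padic_embed y) - (\<Sum>i\<in>UNIV. w $ i * to_fract (x $ i - y $ i)))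
      \<le> ?r ^ Suc s"
    if xy: "reduction k x = reduction k a" "reduction k y = reduction k a" "reduction s x = reduction s y" for x y s
  proof -
    let ?q = "\<lambda>i. q i (padic_embed x, padic_embed y)"
    have "g (padic_embed x) - g (padic_embed y) - (\<Sum>i\<in>UNIV. w $ i * to_fract (x $ i - y $ i))
        = (\<Sum>i\<in>UNIV. (?q i - w $ i) * to_fract (x $ i - y $ i))"
      by (simp add: q padic_embed_def sum_subtractf left_diff_distrib)
    moreover have "fract_abs ((?q i - w $ i) * to_fract (x $ i - y $ i)) \<le> ?r ^ Suc s" for i
    proof -
      have "fract_abs (?q i - w $ i) \<le> ?r"
        using Q(2)[OF k k, OF xy(1,2), of i] by (simp add: dist_fract_def)
      moreover have "residue (x $ i - y $ i) s = 0"
        using xy(3) by (simp add: reduction_eq_iff residue_diff_eq_0_iff)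
      then have "nonarch_abs (x $ i - y $ i) \<le> ?r ^ s"
        by (simp only: nonarch_abs_le_iff)
      ultimately have "fract_abs (?q i - w $ i) * nonarch_abs (x $ i - y $ i) \<le> ?r * ?r ^ s"
        using r by (intro mult_mono nonarch_abs_nonneg) auto
      then show ?thesis
        by (simp only: fract_abs_mult fract_abs_to_fract power_Suc)
    qed
    ultimately show ?thesis
      using r by (simp only:) (intro fract_abs_sum_le zero_le_power; simp)
  qed
  then show ?thesis
    by blast
qed

text \<open>One \<open>k\<close> has to serve for all points of \<open>X\<close> in a ball around \<open>a\<close>, which is what the
  compactness argument uses. This is possible because the equations at \<open>a\<close> also describe \<open>X\<close>
  near these points, and strict differentiability at \<open>a\<close> concerns pairs of points near \<open>a\<close>.\<close>

lemma card_fibre_near_point: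
  fixes X :: "('p::prime_card padic_int ^ 'n::finite) set"
    and V :: "('p padic ^ 'n) set"
  assumes V: "smooth_algebraic_set d V" and X: "openin (top_of_set V) (padic_embed ` X)" and a: "a \<in> X"
  shows "\<exists>k. \<forall>z\<in>X. reduction k z = reduction k a \<longrightarrow> (\<forall>m\<ge>k.
    card (reduction (Suc m) ` {x \<in> X. reduction m x = reduction m z}) = CARD('p) ^ d)"
proof -
  let ?A = "padic_embed a"
  obtain T where T: "open T" "padic_embed ` X = V \<inter> T"
    using X by (auto simp: openin_open)
  then have AV: "?A \<in> V" "?A \<in> T"
    using a by auto
  obtain fs where fs: "length fs + d = CARD('n)"
      "local_ideal ?A (ideal_generated (set fs)) = local_ideal ?A (vanishing_ideal V)"
      "jacobian_rank fs ?A = length fs"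
    using V AV(1) by (auto simp: smooth_algebraic_set_def)
  have "vec.dim ((\<lambda>f. mpoly_gradient f ?A) ` set fs) = length fs"
    using fs(3) by (simp add: jacobian_rank_def mpoly_gradient_def)
  from solved_equations[where F = mpoly_eval and D = "\<lambda>f. mpoly_gradient f ?A", OF strict_gradient_mpoly this]
  obtain J :: "'n set" and g w where J: "card J = length fs"
    and zeros: "\<And>x. (\<forall>j\<in>J. g j x = 0) \<longleftrightarrow> (\<forall>f\<in>set fs. mpoly_eval f x = 0)"
    and g: "\<And>j. j \<in> J \<Longrightarrow> strict_gradient (g j) ?A (w j)"
    and w: "\<And>i j. j \<in> J \<Longrightarrow> i \<in> J \<Longrightarrow> w j $ i = (if i = j then 1 else 0)"
      "\<And>i j. j \<in> J \<Longrightarrow> fract_abs (w j $ i) \<le> 1"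
    by blast
  have J_card: "card (- J) = d"
    using fs(1) J by (simp add: Compl_eq_Diff_UNIV card_Diff_subset)
  have gA: "g j ?A = 0" if "j \<in> J" for j
  proof -
    have "\<forall>f\<in>set fs. mpoly_eval f ?A = 0"
      using eventually_nhds_x_imp_x[OF locally_zeros_of_equations[OF _ AV(1) fs(2)]] V AV(1)
      by (simp add: smooth_algebraic_set_def)
    then show ?thesis
      using zeros that by blast
  qed
  have "\<forall>\<^sub>F x in nhds ?A. x \<in> V \<inter> T \<longleftrightarrow> (\<forall>j\<in>J. g j x = 0)"
    using locally_zeros_of_equations[OF _ AV(1) fs(2)] eventually_nhds_in_open[OF T(1) AV(2)] V
    unfolding zeros smooth_algebraic_set_def by (auto elim: eventually_elim2)
  then obtain k0 where k0: "\<And>x. reduction k0 x = reduction k0 a \<Longrightarrow>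
      padic_embed x \<in> V \<inter> T \<longleftrightarrow> (\<forall>j\<in>J. g j (padic_embed x) = 0)"
    using eventually_near_padic_embed[where a = a and P = "\<lambda>x. x \<in> V \<inter> T \<longleftrightarrow> (\<forall>j\<in>J. g j x = 0)"] by blast
  define good where "good j k \<longleftrightarrow> (\<forall>x y s. reduction k x = reduction k a \<longrightarrow> reduction k y = reduction k a \<longrightarrow>
    reduction s x = reduction s y \<longrightarrow>
    fract_abs (g j (padic_embed x) - g j (padic_embed y) - (\<Sum>i\<in>UNIV. w j $ i * to_fract (x $ i - y $ i)))
      \<le> (1 / real CARD('p)) ^ Suc s)" for j k
  have "\<exists>k. good j k" if "j \<in> J" for j
    unfolding good_def by (rule strict_gradient_near_padic_embed[OF g[OF that]])
  then obtain kk where kk: "\<And>j. j \<in> J \<Longrightarrow> good j (kk j)"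
    by metis
  define k where "k = k0 + (\<Sum>j\<in>J. kk j)"
  have kk_le: "kk j \<le> k" if "j \<in> J" for j
    unfolding k_def using member_le_sum[of j J kk] that by simp
  have near0: "padic_embed x \<in> V \<inter> T \<longleftrightarrow> (\<forall>j\<in>J. g j (padic_embed x) = 0)"
    if "reduction k x = reduction k a" for x
    by (rule k0[OF reduction_antimono[OF that]]) (simp add: k_def)
  have X_iff: "x \<in> X \<longleftrightarrow> padic_embed x \<in> V \<inter> T" for x
    unfolding T(2)[symmetric] by (auto simp: padic_embed_inject)
  have near: "fract_abs (g j (padic_embed x) - g j (padic_embed y) - (\<Sum>i\<in>UNIV. w j $ i * to_fract (x $ i - y $ i)))
      \<le> (1 / real CARD('p)) ^ Suc s"
    if "j \<in> J" "reduction k x = reduction k a" "reduction k y = reduction k a" "reduction s x = reduction s y"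
    for j x y s
    using kk[OF that(1), unfolded good_def] that(4)
      reduction_antimono[OF that(2) kk_le[OF that(1)]] reduction_antimono[OF that(3) kk_le[OF that(1)]]
    by blast
  have "\<forall>j i. \<exists>c :: 'p padic_int. j \<in> J \<longrightarrow> to_fract c = w j $ i"
    using w(2) unfolding integral_iff by (metis rangeE)
  then obtain C :: "'n \<Rightarrow> 'n \<Rightarrow> 'p padic_int" where C: "\<And>j i. j \<in> J \<Longrightarrow> w j $ i = to_fract (C j i)"
    by metis
  have sum_w: "(\<Sum>i\<in>UNIV. w j $ i * to_fract (x $ i - y $ i))
      = to_fract (x $ j - y $ j + (\<Sum>i\<in>-J. C j i * (x $ i - y $ i)))" if j: "j \<in> J" for j x y
  proof -
    have "(\<Sum>i\<in>UNIV. C j i * (x $ i - y $ i))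
        = (\<Sum>i\<in>J. C j i * (x $ i - y $ i)) + (\<Sum>i\<in>-J. C j i * (x $ i - y $ i))"
      by (subst sum.union_disjoint[symmetric]) auto
    also have "(\<Sum>i\<in>J. C j i * (x $ i - y $ i)) = (\<Sum>i\<in>J. if i = j then x $ i - y $ i else 0)"
    proof (rule sum.cong[OF refl])
      fix i assume i: "i \<in> J"
      have "to_fract (C j i) = (if i = j then 1 else 0)"
        using w(1)[OF j i] unfolding C[OF j] .
      also have "\<dots> = to_fract (if i = j then 1 else 0)"
        by simp
      finally have "C j i = (if i = j then 1 else 0)"
        by (simp only: to_fract_eq_iff)
      then show "C j i * (x $ i - y $ i) = (if i = j then x $ i - y $ i else 0)"
        by simp
    qed
    also have "\<dots> = x $ j - y $ j"
      using j by simp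
    finally have "to_fract (\<Sum>i\<in>UNIV. C j i * (x $ i - y $ i))
        = to_fract (x $ j - y $ j + (\<Sum>i\<in>-J. C j i * (x $ i - y $ i)))"
      by (rule arg_cong)
    then show ?thesis
      by (simp add: C[OF j] to_fract_sum to_fract_mult)
  qed
  have integral: "g j (padic_embed x) \<in> range to_fract" if "j \<in> J" "reduction k x = reduction k a" for j x
  proof -
    let ?L = "to_fract (x $ j - a $ j + (\<Sum>i\<in>-J. C j i * (x $ i - a $ i)))"
    have "fract_abs (g j (padic_embed x) - ?L) \<le> (1 / real CARD('p)) ^ Suc 0"
      using near[OF that refl, of 0] gA[OF that(1)] unfolding sum_w[OF that(1)]
      by (simp add: reduction_eq_iff)
    also have "\<dots> \<le> 1"
      by simp
    finally have "fract_abs ((g j (padic_embed x) - ?L) - (- ?L)) \<le> 1"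
      by (rule fract_abs_diff_le) (simp only: fract_abs_minus integral_iff rangeI)
    then show ?thesis
      by (simp add: integral_iff)
  qed
  \<comment> \<open>Near \<open>a\<close> the equations have integral values, so they can be read over the $p$-adic integers.\<close>
  define G where "G j x = (SOME c. to_fract c = g j (padic_embed x))" for j x
  have G: "to_fract (G j x) = g j (padic_embed x)" if jx: "j \<in> J" "reduction k x = reduction k a" for j x
    unfolding G_def by (rule someI_ex) (use integral[OF jx] in \<open>metis rangeE\<close>)
  have G0: "G j x = 0 \<longleftrightarrow> g j (padic_embed x) = 0" if "j \<in> J" "reduction k x = reduction k a" for j x
    using G[OF that] by (metis to_fract_0 to_fract_eq_iff)
  have "card (reduction (Suc m) ` {x \<in> X. reduction m x = reduction m z}) = CARD('p) ^ d"
    if z: "z \<in> X" "reduction k z = reduction k a" and m: "k \<le> m" for z m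
  proof -
    have near_a: "reduction k x = reduction k a" if "reduction m x = reduction m z" for x :: "'p padic_int ^ 'n"
      using reduction_antimono[OF that m] z(2) by simp
    have "x \<in> X \<longleftrightarrow> (\<forall>j\<in>J. G j x = 0)" if "reduction k x = reduction k a" for x
      using X_iff near0[OF that] G0[OF _ that] by simp
    then have "{x \<in> X. reduction m x = reduction m z} = {x. reduction m x = reduction m z \<and> (\<forall>j\<in>J. G j x = 0)}"
      using near_a by auto
    moreover have "card (reduction (Suc m) ` {x. reduction m x = reduction m z \<and> (\<forall>j\<in>J. G j x = 0)})
        = CARD('p) ^ card (- J)"
    proof (rule card_fibre_of_solved_equations[OF _ _ m])
      fix x y :: "'p padic_int ^ 'n" and s j
      assume xy: "reduction k x = reduction k z" "reduction k y = reduction k z" "reduction s x = reduction s y"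
        and j: "j \<in> J"
      let ?L = "x $ j - y $ j + (\<Sum>i\<in>-J. C j i * (x $ i - y $ i))"
      have "fract_abs (to_fract (G j x) - to_fract (G j y) - to_fract ?L) \<le> (1 / real CARD('p)) ^ Suc s"
        using near[OF j, of x y s] xy z(2) G[OF j] unfolding sum_w[OF j] by simp
      then have "nonarch_abs (G j x - G j y - ?L) \<le> (1 / real CARD('p)) ^ Suc s"
        by (simp only: fract_abs_to_fract flip: to_fract_diff)
      then show "residue (G j x - G j y - ?L) (Suc s) = 0"
        by (simp only: nonarch_abs_le_iff)
    next
      fix j assume "j \<in> J"
      then show "G j z = 0"
        using G0[of j z] z near0[of z] X_iff by blast
    qed
    ultimately show ?thesis
      by (simp add: J_card)
  qed
  then show ?thesis
    by blast
qed

section \<open>Counting residue classes\<close>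

theorem corollary28:
  fixes X :: "('p::prime_card padic_int ^ 'n::finite) set"
    and V :: "('p padic ^ 'n) set"
    and d :: nat
  assumes "smooth_algebraic_set d V"
    and "compact (padic_embed ` X)"
    and "openin (top_of_set V) (padic_embed ` X)"
  shows "\<exists>m0>0. \<forall>m\<ge>m0. reduction_count m X = CARD('p) ^ ((m - m0) * d) * reduction_count m0 X"
proof -
  define good where "good a k \<longleftrightarrow> (\<forall>z\<in>X. reduction k z = reduction k a \<longrightarrow> (\<forall>m\<ge>k.
    card (reduction (Suc m) ` {x \<in> X. reduction m x = reduction m z}) = CARD('p) ^ d))"
    for a :: "'p padic_int ^ 'n" and k
  have "\<exists>k. good a k" if "a \<in> X" for a
    unfolding good_def by (rule card_fibre_near_point[OF assms(1,3) that])
  then obtain k where good: "\<And>a. a \<in> X \<Longrightarrow> good a (k a)"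
    by metis
  define B where "B a = ball (padic_embed a) ((1 / real CARD('p)) ^ k a)" for a
  have B: "reduction (k a) z = reduction (k a) a" if "padic_embed z \<in> B a" for a z
    unfolding reduction_eq_iff
  proof
    fix i
    have "dist (padic_embed a $ i) (padic_embed z $ i) \<le> (1 / real CARD('p)) ^ k a"
      using dist_vec_nth_le[of "padic_embed a" i "padic_embed z"] that by (simp add: B_def)
    then have "nonarch_abs (a $ i - z $ i) \<le> (1 / real CARD('p)) ^ k a"
      by (simp add: dist_fract_def padic_embed_def del: power_one_over flip: to_fract_diff)
    then show "residue (z $ i) (k a) = residue (a $ i) (k a)"
      by (simp only: nonarch_abs_le_iff residue_diff_eq_0_iff)
  qed
  have "padic_embed ` X \<subseteq> (\<Union>a\<in>X. B a)" "\<And>a. a \<in> X \<Longrightarrow> open (B a)"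
    by (auto simp: B_def)
  then obtain Y where Y: "Y \<subseteq> X" "finite Y" "padic_embed ` X \<subseteq> (\<Union>a\<in>Y. B a)"
    using compactE_image[OF assms(2)] by metis
  \<comment> \<open>The sum bounds all \<open>k a\<close>; the successor makes \<open>m0\<close> positive.\<close>
  define m0 where "m0 = Suc (\<Sum>a\<in>Y. k a)"
  have fibre: "card (reduction (Suc m) ` {x \<in> X. reduction m x = reduction m z}) = CARD('p) ^ d"
    if z: "z \<in> X" and m: "m0 \<le> m" for z m
  proof -
    obtain a where a: "a \<in> Y" "padic_embed z \<in> B a"
      using Y(3) z by blast
    have "k a \<le> m"
      using member_le_sum[of a Y k] a(1) Y(2) m by (simp add: m0_def)
    then show ?thesis
      using good[of a] a(1) Y(1) z B[OF a(2)] unfolding good_def by blast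
  qed
  have fin: "finite (reduction m ` X)" for m
  proof (rule finite_subset)
    have "(\<lambda>i. residue (x $ i) m) \<in> PiE UNIV (\<lambda>_. {0..<int CARD('p) ^ m})" for x :: "'p padic_int ^ 'n"
      using residue_bounds[where 'p = 'p] by (simp add: PiE_iff)
    then show "reduction m ` X \<subseteq> vec_lambda ` PiE UNIV (\<lambda>_. {0..<int CARD('p) ^ m})"
      by (auto simp: reduction_def)
    show "finite (vec_lambda ` PiE (UNIV :: 'n set) (\<lambda>_. {0..<int CARD('p) ^ m}))"
      by (intro finite_imageI finite_PiE) auto
  qed
  have step: "reduction_count (Suc m) X = CARD('p) ^ d * reduction_count m X" if m: "m0 \<le> m" for m
  proof -
    let ?F = "\<lambda>c. reduction (Suc m) ` {x \<in> X. reduction m x = c}"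
    have "reduction (Suc m) ` X = (\<Union>c\<in>reduction m ` X. ?F c)"
      by blast
    moreover have "?F c \<inter> ?F c' = {}" if "c \<noteq> c'" for c c'
      using that reduction_antimono[of "Suc m" _ _ m] by fastforce
    ultimately have "card (reduction (Suc m) ` X) = (\<Sum>c\<in>reduction m ` X. card (?F c))"
      by (simp only:) (intro card_UN_disjoint fin ballI finite_subset[OF _ fin[of "Suc m"]]; blast)
    also have "\<dots> = (\<Sum>c\<in>reduction m ` X. CARD('p) ^ d)"
      using fibre[OF _ m] by (intro sum.cong) auto
    finally show ?thesis
      by (simp add: reduction_count_def)
  qed
  have "reduction_count (m0 + t) X = CARD('p) ^ (t * d) * reduction_count m0 X" for t
    by (induction t) (simp_all add: step power_add)
  then have "\<forall>m\<ge>m0. reduction_count m X = CARD('p) ^ ((m - m0) * d) * reduction_count m0 X"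
    by (metis le_add_diff_inverse)
  moreover have "0 < m0"
    by (simp add: m0_def)
  ultimately show ?thesis
    by blast
qed

end
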